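(* Let $N\ge1$, $1\le C\le N$, $T\ge1$, $S\ge 1$ and $k\ge 0$ be integers, and let $x^T\in[N]^T$ be any file request sequence. Let $\pi_k^{\textsc{Sage}}(x^T)$ be the expected hit rate on $x^T$ of the online policy that runs the $k$-th order Markov state machine and, at each of its $N^k$ states, an independent copy of the \textsc{Sage} caching policy fed only with the requests arriving while the machine is in that state. Then $$T\big(\tilde{\pi}_S(x^T)-\pi_k^{\textsc{Sage}}(x^T)\big)\le T\min\Big(1-\frac CN,\sqrt{\frac{\ln S}{2(k+1)}}\Big)+\sqrt{2N^kCL^*_{T,k}\ln\frac{Ne}{C}}+N^kC\ln\frac{Ne}{C},$$ where $L^*_{T,k}$ is the minimum number of cache misses on $x^T$ incurred by any $k$-th order Markov prefetcher.
   Context: Caching setting: a library of $N$ unit-sized files $[N]$ and a cache holding $C$ files. In round $t$ a set of $C$ files is placed in the cache (possibly at random), then file $x_t\in[N]$ is requested; a cache hit (reward 1) occurs if $x_t$ is in the cache, otherwise reward 0. The hit rate of a policy on $x^T$ is its expected number of hits divided by $T$. A Finite State Prefetcher (FSP) is a quintuple $(\mathcal{S},[N],g,f,s_0)$: finite state set $\mathcal S$, transition $g:\mathcal S\times[N]\to\mathcal S$, possibly randomized prefetching function $f$ mapping each state to a set of $C$ files, initial state $s_0$; at round $t$ in state $s_t$ it caches $f(s_t)$, observes $x_t$, and moves to $g(s_t,x_t)$. $\tilde{\pi}_S(x^T)$ is the maximum hit rate on $x^T$ of any FSP with at most $S$ states. A $k$-th order Markov prefetcher is an FSP with state set $[N]^k$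 whose state at round $t$ is $(x_{t-1},\dots,x_{t-k})$, with the shift transition function (a single state if $k=0$). The \textsc{Sage} caching policy (run on a request stream $x_1,x_2,\dots$): maintain weights $w(i)=\exp(\eta R(i))$ where $R(i)$ is the number of past requests for file $i$ and $\eta>0$ is the learning rate; each round compute marginals $p(i)=w(i)\,e_{C-1}(\mathbf w_{-i})/e_C(\mathbf w)$, where $e_m$ is the elementary symmetric polynomial of order $m$ and $\mathbf w_{-i}$ omits coordinate $i$ (these are exactly the file-inclusion marginals of the Hedge algorithm with experts all $C$-subsets of $[N]$, expert $A$ earning reward $\mathbb 1(x_t\in A)$), and cache a random $C$-set with $\Pr(i\text{ cached})=p(i)$ via Madow's systematic sampling (draw $U\sim\mathrm{Unif}[0,1]$, set $P_0=0$, $P_i=P_{i-1}+p(i)$, and select for each $m=0,\dots,C-1$ the index $j$ with $P_{j-1}\le U+m\le P_j$). The learning rate is tuned adaptively (the standard small-loss tuning of Hedge) so that on every request sequence of length $n$ the policy's expected number of hits is at least the number of hits of the best fixed $C$-set minus $\sqrt{2C\,l^*\ln(Ne/C)}+C\ln(Ne/C)$, where $l^*$ is the number of misses of the best fixed $C$-set. *)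

theory Defs
  imports "HOL-Probability.Probability"
begin

text \<open>Files are [N] = {1..N}; request sequences are lists (round t, 0-indexed, requests xs ! t).
  A randomized prefetching decision is a pmf over C-subsets of [N]; a cache hit in a round has
  probability prob(requested file in the cached set).\<close>

definition files :: "nat \<Rightarrow> nat set" where
  "files N = {1..N}"

definition csets :: "nat \<Rightarrow> nat \<Rightarrow> nat set set" where
  "csets N C = {A. A \<subseteq> files N \<and> card A = C}"

definition valid_seq :: "nat \<Rightarrow> nat list \<Rightarrow> bool" where
  "valid_seq N xs \<longleftrightarrow> set xs \<subseteq> files N"

definition hit_prob :: "nat set pmf \<Rightarrow> nat \<Rightarrow> real" where
  "hit_prob D x = measure_pmf.prob D {A. x \<in> A}"

definition is_FSP :: "nat \<Rightarrow> nat \<Rightarrow> nat set \<Rightarrow> (nat \<Rightarrow> nat \<Rightarrow> nat) \<Rightarrow> (nat \<Rightarrow> nat set pmf) \<Rightarrow> nat \<Rightarrow> bool" where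
  "is_FSP N C Q g f s0 \<longleftrightarrow> finite Q \<and> s0 \<in> Q
     \<and> (\<forall>q\<in>Q. \<forall>a\<in>files N. g q a \<in> Q)
     \<and> (\<forall>q\<in>Q. set_pmf (f q) \<subseteq> csets N C)"

fun fsp_state :: "(nat \<Rightarrow> nat \<Rightarrow> nat) \<Rightarrow> nat \<Rightarrow> nat list \<Rightarrow> nat \<Rightarrow> nat" where
  "fsp_state g s0 xs 0 = s0"
| "fsp_state g s0 xs (Suc t) = g (fsp_state g s0 xs t) (xs ! t)"

definition fsp_hit_rate :: "(nat \<Rightarrow> nat \<Rightarrow> nat) \<Rightarrow> (nat \<Rightarrow> nat set pmf) \<Rightarrow> nat \<Rightarrow> nat list \<Rightarrow> real" where
  "fsp_hit_rate g f s0 xs =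
     (\<Sum>t<length xs. hit_prob (f (fsp_state g s0 xs t)) (xs ! t)) / real (length xs)"

definition best_fsp_rate :: "nat \<Rightarrow> nat \<Rightarrow> nat \<Rightarrow> nat list \<Rightarrow> real" where
  "best_fsp_rate N C S xs =
     (SUP (Q, g, f, s0) \<in> {(Q, g, f, s0). is_FSP N C Q g f s0 \<and> card Q \<le> S}.
        fsp_hit_rate g f s0 xs)"

text \<open>The list pre (of length k) gives the virtual requests preceding round 0 (fixing the initial
  state s0 of the Markov machine).  The state at round t is [x_{t-1}, ..., x_{t-k}].\<close>

definition markov_state :: "nat list \<Rightarrow> nat list \<Rightarrow> nat \<Rightarrow> nat list" where
  "markov_state pre xs t = take (length pre) (rev (pre @ take t xs))"

definition markov_misses :: "nat list \<Rightarrow> (nat list \<Rightarrow> nat set pmf) \<Rightarrow> nat list \<Rightarrow> real" where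
  "markov_misses pre f xs =
     (\<Sum>t<length xs. 1 - hit_prob (f (markov_state pre xs t)) (xs ! t))"

definition markov_Lstar :: "nat \<Rightarrow> nat \<Rightarrow> nat list \<Rightarrow> nat list \<Rightarrow> real" where
  "markov_Lstar N C pre xs =
     (INF f \<in> {f. \<forall>s. set_pmf (f s) \<subseteq> csets N C}. markov_misses pre f xs)"

definition esym :: "nat \<Rightarrow> nat set \<Rightarrow> (nat \<Rightarrow> real) \<Rightarrow> real" where
  "esym m A w = (\<Sum>B\<in>{B. B \<subseteq> A \<and> card B = m}. \<Prod>i\<in>B. w i)"

text \<open>Inclusion marginal of file i after history h, learning rate schedule eta
  (eta h is the learning rate used after seeing the history h).  By Madow's systematic
  sampling, file i is cached with probability exactly this marginal.\<close>

definition sage_marg :: "nat \<Rightarrow> nat \<Rightarrow> (nat list \<Rightarrow> real) \<Rightarrow> nat list \<Rightarrow> nat \<Rightarrow> real" where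
  "sage_marg N C eta h i =
     (let w = (\<lambda>j. exp (eta h * real (count_list h j)))
      in w i * esym (C - 1) (files N - {i}) w / esym C (files N) w)"

definition sage_hits :: "nat \<Rightarrow> nat \<Rightarrow> (nat list \<Rightarrow> real) \<Rightarrow> nat list \<Rightarrow> real" where
  "sage_hits N C eta ys = (\<Sum>t<length ys. sage_marg N C eta (take t ys) (ys ! t))"

definition fixed_hits :: "nat set \<Rightarrow> nat list \<Rightarrow> nat" where
  "fixed_hits A ys = card {t. t < length ys \<and> ys ! t \<in> A}"

definition best_fixed_hits :: "nat \<Rightarrow> nat \<Rightarrow> nat list \<Rightarrow> nat" where
  "best_fixed_hits N C ys = Max ((\<lambda>A. fixed_hits A ys) ` csets N C)"

definition sage_tuned :: "nat \<Rightarrow> nat \<Rightarrow> (nat list \<Rightarrow> real) \<Rightarrow> bool" where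
  "sage_tuned N C eta \<longleftrightarrow> (\<forall>h. eta h > 0) \<and>
     (\<forall>ys. valid_seq N ys \<longrightarrow>
        sage_hits N C eta ys \<ge> real (best_fixed_hits N C ys)
          - sqrt (2 * real C * real (length ys - best_fixed_hits N C ys) * ln (real N * exp 1 / real C))
          - real C * ln (real N * exp 1 / real C))"

definition markov_sage_rate :: "nat \<Rightarrow> nat \<Rightarrow> (nat list \<Rightarrow> real) \<Rightarrow> nat list \<Rightarrow> nat list \<Rightarrow> real" where
  "markov_sage_rate N C eta pre xs =
     (\<Sum>t<length xs.
        sage_marg N C eta
          [xs ! j. j \<leftarrow> [0..<t], markov_state pre xs j = markov_state pre xs t] (xs ! t))
     / real (length xs)"

end

theory Submission
  imports Defs
begin

text \<open>
  Running one copy of Sage per Markov state costs at most the two regret terms against the best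
  Markov prefetcher, by Cauchy--Schwarz over the \<open>N ^ k\<close> states. It remains to
  bound the number G of hits by which an S-state FSP beats the best Markov prefetcher of order k.

  For \<open>j \<le> k\<close> consider the windows of length j followed by one more request, and let
  \<open>D j\<close> be the empirical entropy (in nats, times the number of windows) of the FSP state at
  the start of a window given the window. State and window determine the FSP's next decision, the
  window alone is known to the Markov prefetcher, so Hoeffding's lemma (Pinsker's inequality)
  gives \<open>2 (G - j)\<^sup>2 / (T - j) \<le> D j - D (j + 1)\<close>, while \<open>D 0 \<le> T ln S\<close>.
  The losses j come from windows that would have to start before time 0. They are compensated at the
  last level: with \<open>g = G / T\<close>, imitating a state drawn from its conditional
  distribution given the window shows that \<open>D k\<close> is about \<open>- T ln (1 - g)\<close> or more, which exceeds the \<open>2 T g\<^sup>2\<close> that Pinsker's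
  inequality would give. This surplus suffices because the claim is trivial unless T exceeds the
  regret constant \<open>N ^ k C ln (N e / C)\<close> by a factor
  \<open>1 / (1 - sqrt (d (2 - d)))\<close>, where d is the square root in the bound.
\<close>

subsection \<open>Real inequalities\<close>

text \<open>Hoeffding's lemma for the uniform distribution on \<open>V\<close>, with the bound
  \<open>exp (l^2 / 8)\<close> moved to the left. In this form it can be summed over fibres.\<close>

lemma hoeffding_sum:
  fixes y :: "'a \<Rightarrow> real"
  assumes fin: "finite V" and ne: "V \<noteq> {}" and y: "\<And>v. v \<in> V \<Longrightarrow> 0 \<le> y v \<and> y v \<le> 1" and l: "l > 0"
  shows "(\<Sum>v\<in>V. exp (l * (y v - (\<Sum>w\<in>V. y w) / card V) - l\<^sup>2 / 8)) \<le> card V"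
proof -
  let ?p = "pmf_of_set V"
  define m where "m = (\<Sum>w\<in>V. y w) / card V"
  have c: "real (card V) > 0" using fin ne by (simp add: card_gt_0_iff)
  interpret I: interval_bounded_random_variable "measure_pmf ?p" y 0 1
    by unfold_locales (use y fin ne in \<open>auto simp: AE_measure_pmf_iff\<close>)
  have E: "measure_pmf.expectation ?p y = m"
    unfolding m_def by (rule integral_pmf_of_set[OF ne fin])
  have "(\<integral>\<^sup>+ x. ennreal (exp (l * (y x - m))) \<partial>measure_pmf ?p) \<le> ennreal (exp (l\<^sup>2 * (1 - 0)\<^sup>2 / 8))"
    using I.Hoeffdings_lemma_nn_integral[OF l] E by simp
  also have "(\<integral>\<^sup>+ x. ennreal (exp (l * (y x - m))) \<partial>measure_pmf ?p)
     = ennreal (measure_pmf.expectation ?p (\<lambda>x. exp (l * (y x - m))))"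
    by (intro nn_integral_eq_integral integrable_measure_pmf_finite) (use fin ne in auto)
  finally have "measure_pmf.expectation ?p (\<lambda>x. exp (l * (y x - m))) \<le> exp (l\<^sup>2 / 8)"
    by simp
  then have "(\<Sum>x\<in>V. exp (l * (y x - m))) / card V \<le> exp (l\<^sup>2 / 8)"
    by (simp add: integral_pmf_of_set[OF ne fin])
  then have "(\<Sum>x\<in>V. exp (l * (y x - m))) \<le> exp (l\<^sup>2 / 8) * card V"
    using c by (simp add: field_simps)
  moreover have "exp (l * (y x - m) - l\<^sup>2 / 8) = exp (l * (y x - m)) / exp (l\<^sup>2 / 8)" for x
    by (rule exp_diff)
  ultimately show ?thesis
    by (simp add: m_def[symmetric] sum_divide_distrib[symmetric] divide_le_eq mult.commute)
qed

lemma ln2_bound: "ln 2 \<ge> (693::real) / 1000"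
  using ln_approx_bounds[of 2 3, simplified, simplified eval_nat_numeral, simplified] by simp

text \<open>A Taylor polynomial of \<open>- ln (1 - x)\<close>; the difference has derivative
  \<open>z^4 / (1 - z)\<close>. It supplies the decimal bounds for small \<open>k\<close>.\<close>

lemma minus_ln_ge_poly:
  fixes x :: real
  assumes "0 \<le> x" "x < 1"
  shows "- ln (1 - x) \<ge> x + x^2/2 + x^3/3 + x^4/4"
proof -
  define h where "h = (\<lambda>x::real. - ln (1 - x) - (x + x^2/2 + x^3/3 + x^4/4))"
  have "h 0 \<le> h x"
  proof (rule DERIV_nonneg_imp_nondecreasing[OF assms(1)])
    fix z assume z: "0 \<le> z" "z \<le> x"
    then have z1: "z < 1" using assms by simp
    have "(h has_real_derivative (1 / (1 - z) - (1 + z + z^2 + z^3))) (at z)"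
      unfolding h_def using z1
      by (auto intro!: derivative_eq_intros simp: field_simps)
    moreover have "1 / (1 - z) - (1 + z + z^2 + z^3) = z^4 / (1 - z)"
      using z1 by (simp add: field_simps eval_nat_numeral)
    ultimately show "\<exists>y. (h has_real_derivative y) (at z) \<and> 0 \<le> y"
      using z z1 by (intro exI[of _ "z^4 / (1 - z)"]) auto
  qed
  then show ?thesis by (simp add: h_def)
qed

text \<open>This is the surplus of the imitation bound over the Pinsker bound, per round. Its
  derivative is \<open>(1 - 2 * z)^2 / (1 - z)\<close>.\<close>

lemma minus_ln_minus_two_sq_mono:
  fixes x y :: real
  assumes "x \<le> y" "y < 1"
  shows "- ln (1 - x) - 2 * x^2 \<le> - ln (1 - y) - 2 * y^2"
proof -
  define f where "f = (\<lambda>x::real. - ln (1 - x) - 2 * x^2)"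
  have "f x \<le> f y"
  proof (rule DERIV_nonneg_imp_nondecreasing[OF assms(1)])
    fix z assume "x \<le> z" "z \<le> y"
    then have z1: "z < 1" using assms by simp
    have "(f has_real_derivative (1 / (1 - z) - 4 * z)) (at z)"
      unfolding f_def using z1
      by (auto intro!: derivative_eq_intros simp: field_simps)
    moreover have "1 / (1 - z) - 4 * z = (1 - 2 * z)^2 / (1 - z)"
      using z1 by (simp add: field_simps eval_nat_numeral)
    ultimately show "\<exists>d. (f has_real_derivative d) (at z) \<and> 0 \<le> d"
      using z1 by (intro exI[of _ "(1 - 2 * z)^2 / (1 - z)"]) auto
  qed
  then show ?thesis by (simp add: f_def)
qed

text \<open>Convexity of \<open>x * ln x\<close>. The case \<open>m = 0\<close> is separate because
  the derivative is available only at positive arguments.\<close>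

lemma diff_xlnx_mono:
  fixes m n :: nat
  assumes "m \<le> n"
  shows "(real m + 1) * ln (real m + 1) - real m * ln (real m)
       \<le> (real n + 1) * ln (real n + 1) - real n * ln (real n)"
proof (cases "m = 0")
  case True
  have "real n * ln (real n) \<le> (real n + 1) * ln (real n + 1)"
  proof (cases "n = 0")
    case False
    then show ?thesis by (intro mult_mono) auto
  qed simp
  then show ?thesis using True by simp
next
  case False
  define f where "f = (\<lambda>x::real. (x + 1) * ln (x + 1) - x * ln x)"
  have "f m \<le> f n"
  proof (rule DERIV_nonneg_imp_nondecreasing[of "real m" "real n"])
    show "real m \<le> real n" using assms by simp
    fix z assume "real m \<le> z"
    then have z: "z > 0" using False by simp
    have "(f has_real_derivative (ln (z + 1) - ln z)) (at z)"
      unfolding f_def using z by (auto intro!: derivative_eq_intros)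
    then show "\<exists>d. (f has_real_derivative d) (at z) \<and> 0 \<le> d"
      using z by (intro exI[of _ "ln (z + 1) - ln z"]) auto
  qed
  then show ?thesis by (simp add: f_def)
qed

text \<open>The factor 1693/1000 is a lower bound of 1 + ln 2.\<close>
lemma boundary_terms_bound:
  fixes d e :: real and k :: nat
  assumes k: "k \<ge> 1" and d0: "0 < d" and d1: "d < 1"
    and dk: "ln 2 \<le> 2 * (real k + 1) * d\<^sup>2"
    and e: "e = sqrt (d * (2 - d))"
  shows "real k * (1 - e) * ((real k - 1) * e\<^sup>2 + 1 - ln (1 - d))
       \<le> 1693 / 1000 * 2 ^ k * (- ln (1 - d) - 2 * d\<^sup>2)"
proof -
  define f where "f = - ln (1 - d) - 2 * d\<^sup>2"
  have e2: "e\<^sup>2 = d * (2 - d)" using d0 d1 e by simp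
  have e0: "e > 0" using d0 d1 e by simp
  have omd: "(1 - d)\<^sup>2 = 1 - e\<^sup>2" using e2 by (simp add: power2_eq_square algebra_simps)
  have "0 < (1 - d)\<^sup>2" using d1 by simp
  then have e21: "e\<^sup>2 < 1\<^sup>2" using omd by simp
  then have e1: "e < 1" by (rule power2_less_imp_less) simp
  \<comment> \<open>By \<open>omd\<close> the logarithm is half of
    \<open>ln (1 / (1 - e^2))\<close>. The factor \<open>1 - e\<close> cancels the pole at
    \<open>e = 1\<close>, and \<open>e / (1 + e)\<close> is at most \<open>1 / 2\<close>.\<close>
  have p: "(1 - e) * (- ln (1 - d)) \<le> e / 4"
  proof -
    have "- 2 * ln (1 - d) = - ln ((1 - d)\<^sup>2)"
      using d1 by (simp add: ln_realpow)
    also have "\<dots> = ln (1 / (1 - e\<^sup>2))"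
      using omd e21 by (simp add: ln_div)
    also have "\<dots> \<le> 1 / (1 - e\<^sup>2) - 1"
      using e21 by (intro ln_le_minus_one) simp
    also have "\<dots> = e\<^sup>2 / ((1 - e) * (1 + e))"
    proof -
      have "1 / (1 - e\<^sup>2) - 1 = e\<^sup>2 / (1 - e\<^sup>2)"
        using e21 diff_divide_distrib[of 1 "1 - e\<^sup>2" "1 - e\<^sup>2"] by simp
      moreover
      have "(1 - e) * (1 + e) = 1 - e\<^sup>2" by (simp add: power2_eq_square algebra_simps)
      ultimately show ?thesis by simp
    qed
    finally have "(1 - e) * (- 2 * ln (1 - d)) \<le> (1 - e) * (e\<^sup>2 / ((1 - e) * (1 + e)))"
      using e1 by (intro mult_left_mono) auto
    also have "\<dots> = e * (e / (1 + e))"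
      using e1 by (simp add: power2_eq_square)
    also have "\<dots> \<le> e * (1 / 2)"
      using e0 e1 by (intro mult_left_mono) (auto simp: field_simps)
    finally show ?thesis by simp
  qed
  \<comment> \<open>With the logarithm on the left replaced through \<open>p\<close>, the left side
    is a polynomial in \<open>e\<close> for fixed \<open>k\<close>, and \<open>d\<close> enters the
    right side only through \<open>f\<close>.\<close>
  have main: ?thesis
    if *: "real k * ((1 - e) * (1 + (real k - 1) * e\<^sup>2) + e / 4) \<le> 1693 / 1000 * 2 ^ k * f"
  proof -
    have "real k * (1 - e) * ((real k - 1) * e\<^sup>2 + 1 - ln (1 - d))
        = real k * ((1 - e) * (1 + (real k - 1) * e\<^sup>2) + (1 - e) * (- ln (1 - d)))"
      by (simp add: algebra_simps)
    also have "\<dots> \<le> real k * ((1 - e) * (1 + (real k - 1) * e\<^sup>2) + e / 4)"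
      using p by (intro mult_left_mono add_mono order_refl) auto
    finally show ?thesis using * by (simp add: f_def)
  qed
  \<comment> \<open>These three facts carry a numerical lower bound on \<open>d\<close> over to
    \<open>f\<close> and \<open>e\<close>, both of which increase with \<open>d\<close>.\<close>
  have dge: "c \<le> d" if "c \<ge> 0" "2 * (real k + 1) * c\<^sup>2 \<le> 693 / 1000" for c
  proof (rule power2_le_imp_le)
    have "2 * (real k + 1) * c\<^sup>2 \<le> 2 * (real k + 1) * d\<^sup>2"
      using that dk ln2_bound by linarith
    then show "c\<^sup>2 \<le> d\<^sup>2" by simp
  qed (use d0 in simp)
  have fge: "f \<ge> c + c^2/2 + c^3/3 + c^4/4 - 2 * c\<^sup>2" if "c \<ge> 0" "c \<le> d" for c
    using minus_ln_ge_poly[of c] minus_ln_minus_two_sq_mono[of c d] that d1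
    unfolding f_def by linarith
  have ege: "c \<le> e" if "c \<ge> 0" "b \<ge> 0" "b \<le> d" "c\<^sup>2 \<le> b * (2 - b)" for b c
  proof (rule power2_le_imp_le)
    have "0 \<le> (d - b) * (2 - (d + b))" using that d1 by (intro mult_nonneg_nonneg) auto
    then show "c\<^sup>2 \<le> e\<^sup>2" using that(4) e2 by (simp add: algebra_simps)
  qed (use e0 in simp)
  \<comment> \<open>Up to \<open>k = 4\<close> the margin is small and decimal bounds are used; from
    \<open>k = 5\<close> on, the growth of \<open>2 ^ k\<close> leaves room for a cruder
    estimate.\<close>
  consider "k = 1" | "k = 2" | "k = 3" | "k = 4" | "k \<ge> 5" using k by linarith
  then show ?thesis
  proof cases
    case 1
    have d: "416/1000 \<le> d" by (rule dge) (simp_all add: 1 power2_eq_square)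
    have "f \<ge> 18/100" using fge[OF _ d] by (simp add: eval_nat_numeral)
    then show ?thesis using ege[OF _ _ d, of "8/10"] e0 e1 by (intro main) (simp add: 1 eval_nat_numeral)
  next
    case 2
    have d: "339/1000 \<le> d" by (rule dge) (simp_all add: 2 power2_eq_square)
    have f: "f \<ge> 18/100" using fge[OF _ d] by (simp add: eval_nat_numeral)
    have e34: "e \<ge> 3/4" using ege[OF _ _ d, of "3/4"] by (simp add: eval_nat_numeral)
    \<comment> \<open>Expanding the product shows that the cubic in the next claim is at most its
      value at the lower end \<open>3/4\<close> of the range of \<open>e\<close>. The cases
      \<open>k = 3\<close> and \<open>k = 4\<close> use the same factorisation.\<close>
    have "0 \<le> (e - 3/4) * (e * e - 1/4 * e + 9/16)"
      using e34 mult_left_mono[OF e34, of e] e0 e1 by (intro mult_nonneg_nonneg) linarith+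
    then have "(1 - e) * (1 + e\<^sup>2) + e / 4 \<le> 58/100"
      by (simp add: field_simps power2_eq_square)
    then show ?thesis using f by (intro main) (simp add: 2)
  next
    case 3
    have d: "294/1000 \<le> d" by (rule dge) (simp_all add: 3 power2_eq_square)
    have f: "f \<ge> 1746/10000" using fge[OF _ d] by (simp add: eval_nat_numeral)
    have e7: "e \<ge> 7/10" using ege[OF _ _ d, of "7/10"] by (simp add: eval_nat_numeral)
    have "0 \<le> (e - 7/10) * (2 * (e * e) - 6/10 * e + 33/100)"
      using e7 mult_left_mono[OF e7, of e] e0 e1 by (intro mult_nonneg_nonneg) linarith+
    then have "(1 - e) * (1 + 2 * e\<^sup>2) + e / 4 \<le> 7751/10000"
      by (simp add: field_simps power2_eq_square)
    then show ?thesis using f by (intro main) (simp add: 3)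
  next
    case 4
    have d: "263/1000 \<le> d" by (rule dge) (simp_all add: 4 power2_eq_square)
    have f: "f \<ge> 16/100" using fge[OF _ d] by (simp add: eval_nat_numeral)
    have e6: "e \<ge> 6/10" using ege[OF _ _ d, of "6/10"] by (simp add: eval_nat_numeral)
    have "0 \<le> (e - 6/10) * (3 * (e * e) - 12/10 * e + 3/100)"
      using e6 mult_left_mono[OF e6, of e] e0 e1 by (intro mult_nonneg_nonneg) linarith+
    then have "(1 - e) * (1 + 3 * e\<^sup>2) + e / 4 \<le> 99/100"
      by (simp add: field_simps power2_eq_square)
    then show ?thesis using f by (intro main) (simp add: 4)
  next
    case 5
    \<comment> \<open>A rational lower bound for \<open>d\<close>: the square root of
      \<open>k + 1\<close> is replaced by \<open>(k + 10) / 6\<close>, its tangent at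
      \<open>k = 8\<close>, whence the square of \<open>k - 8\<close> below.\<close>
    define c where "c = 7 / (2 * (real k + 10))"
    have c0: "c > 0" by (simp add: c_def)
    have "(real k + 1) * 49 * 1000 \<le> 2 * 693 * (real k + 10)\<^sup>2"
    proof -
      have "0 \<le> (real k - 8)\<^sup>2" by simp
      then show ?thesis by (simp add: power2_eq_square algebra_simps)
    qed
    then have "2 * (real k + 1) * c\<^sup>2 \<le> 693 / 1000"
      by (simp add: c_def power_divide divide_simps power2_eq_square) (simp add: algebra_simps)?
    then have cd: "c \<le> d" using c0 by (intro dge) auto
    have "c \<le> 7/30" using 5 by (simp add: c_def field_simps)
    then have "c * c \<le> c * (7/30)" using c0 by (intro mult_left_mono) auto
    moreover have "c^3 \<ge> 0" "c^4 \<ge> 0" using c0 by auto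
    moreover have "c + c * c / 2 + c^3 / 3 + c^4 / 4 - 2 * (c * c) \<le> f"
      using fge[OF _ cd] c0 by (simp add: power2_eq_square)
    ultimately have f: "f \<ge> 65/100 * c" by linarith
    \<comment> \<open>The constant \<open>385/100\<close> is just below
      \<open>1693/1000 * 65/100 * 7/2\<close>, the product of the lower bounds for the factor,
      \<open>f / c\<close> and \<open>c * (k + 10)\<close>.\<close>
    have grow: "real n * (17/20 + 3/20 * real n) * (real n + 10) \<le> 385/100 * 2 ^ n" if "n \<ge> 5" for n
      using that
    proof (induction n rule: nat_induct_at_least)
      case base
      then show ?case by (simp add: eval_nat_numeral)
    next
      case (Suc n)
      then have n5: "real n \<ge> 5" by simp
      have "real (Suc n) * (17/20 + 3/20 * real (Suc n)) * (real (Suc n) + 10)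
          \<le> 2 * (real n * (17/20 + 3/20 * real n) * (real n + 10))"
      proof -
        have "2 * (real n * (17/20 + 3/20 * real n) * (real n + 10))
            - real (Suc n) * (17/20 + 3/20 * real (Suc n)) * (real (Suc n) + 10)
            = (3 * real n ^ 3 + 38 * real n ^ 2 + 67 * real n - 220) / 20"
          by (simp add: field_simps eval_nat_numeral)
        also have "\<dots> \<ge> 0"
        proof -
          have "real n ^ 3 \<ge> 0" "real n ^ 2 \<ge> 0" by simp_all
          then have "3 * real n ^ 3 + 38 * real n ^ 2 + 67 * real n - 220 \<ge> 0" using n5 by linarith
          then show ?thesis by simp
        qed
        finally show ?thesis by (simp only: diff_ge_0_iff_ge)
      qed
      then show ?case using Suc.IH by simp
    qed
    \<comment> \<open>On \<open>[0, 1]\<close> the maximum of \<open>(1 - e) * e^2\<close> is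
      \<open>4/27\<close>, attained at \<open>e = 2/3\<close>.\<close>
    have "0 \<le> (e - 2/3)\<^sup>2 * (e + 1/3)" using e0 by simp
    then have cub: "(1 - e) * e\<^sup>2 \<le> 3/20"
      by (simp add: field_simps power2_eq_square)
    have "(1 - e) * (1 + (real k - 1) * e\<^sup>2) + e / 4
        = 1 - 3/4 * e + (real k - 1) * ((1 - e) * e\<^sup>2)"
      by (simp add: algebra_simps)
    also have "\<dots> \<le> 1 + (real k - 1) * (3/20)"
      using cub e0 5 by (intro add_mono mult_left_mono) auto
    finally have "real k * ((1 - e) * (1 + (real k - 1) * e\<^sup>2) + e / 4)
       \<le> real k * (17/20 + 3/20 * real k)"
      by (intro mult_left_mono) (simp_all add: field_simps)
    also have "\<dots> \<le> 385/100 * 2 ^ k / (real k + 10)"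
      using grow[OF 5] by (subst pos_le_divide_eq) simp_all
    also have "\<dots> \<le> 1693 / 1000 * 2 ^ k * (65/100 * c)"
      by (simp add: c_def field_simps)
    also have "\<dots> \<le> 1693 / 1000 * 2 ^ k * f"
      using f by (intro mult_left_mono) auto
    finally show ?thesis by (rule main)
  qed
qed

subsection \<open>Empirical conditional entropy\<close>

definition fibre :: "'a set \<Rightarrow> ('a \<Rightarrow> 'k) \<Rightarrow> 'a \<Rightarrow> 'a set" where
  "fibre U c u = {v \<in> U. c v = c u}"

definition nfib :: "'a set \<Rightarrow> ('a \<Rightarrow> 'k) \<Rightarrow> 'a \<Rightarrow> real" where
  "nfib U c u = real (card (fibre U c u))"

text \<open>For \<open>u\<close> uniform on \<open>U\<close>, each summand is minus the logarithm of
  the conditional probability of \<open>s u\<close> given \<open>c u\<close>. The sum is left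
  undivided by \<open>card U\<close>, which makes it monotone in \<open>U\<close>.\<close>

definition cond_ent :: "'a set \<Rightarrow> ('a \<Rightarrow> 'k) \<Rightarrow> ('a \<Rightarrow> 's) \<Rightarrow> real" where
  "cond_ent U c s = (\<Sum>u\<in>U. ln (nfib U c u) - ln (nfib U (\<lambda>v. (c v, s v)) u))"

text \<open>Total reward when the decision of \<open>u\<close> meets the outcome of an independent
  random point with the same context, so that decision and outcome are conditionally independent
  given \<open>c\<close>.\<close>

definition mix_gain :: "'a set \<Rightarrow> ('a \<Rightarrow> 'k) \<Rightarrow> ('a \<Rightarrow> 'a \<Rightarrow> real) \<Rightarrow> real" where
  "mix_gain U c \<psi> = (\<Sum>u\<in>U. (\<Sum>v\<in>fibre U c u. \<psi> u v) / nfib U c u)"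

section \<open>Double counting over fibres\<close>

lemma fibre_eq: "v \<in> fibre U c u \<Longrightarrow> fibre U c v = fibre U c u"
  by (auto simp: fibre_def)

lemma nfib_eq: "v \<in> fibre U c u \<Longrightarrow> nfib U c v = nfib U c u"
  by (simp add: nfib_def fibre_eq)

lemma finite_fibre: "finite U \<Longrightarrow> finite (fibre U c u)"
  by (simp add: fibre_def)

lemma nfib_pos: "finite U \<Longrightarrow> u \<in> U \<Longrightarrow> nfib U c u > 0"
  by (auto simp: nfib_def fibre_def card_gt_0_iff)

lemma nfib_mono:
  assumes "finite U" "\<And>v. v \<in> U \<Longrightarrow> c v = c u \<Longrightarrow> c' v = c' u"
  shows "nfib U c u \<le> nfib U c' u"
  unfolding nfib_def fibre_def using assms by (intro of_nat_mono card_mono) auto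

lemma sum_fibre_swap:
  assumes "finite U"
  shows "(\<Sum>u\<in>U. \<Sum>v\<in>fibre U c u. g u v) = (\<Sum>v\<in>U. \<Sum>u\<in>fibre U c v. g u v)"
proof -
  have "(\<Sum>u\<in>U. \<Sum>v\<in>fibre U c u. g u v) = (\<Sum>u\<in>U. \<Sum>v\<in>U. if c v = c u then g u v else 0)"
    using assms by (simp add: fibre_def sum.inter_filter)
  also have "\<dots> = (\<Sum>v\<in>U. \<Sum>u\<in>U. if c v = c u then g u v else 0)"
    by (rule sum.swap)
  also have "\<dots> = (\<Sum>v\<in>U. \<Sum>u\<in>U. if c u = c v then g u v else 0)"
    by (simp add: eq_commute)
  also have "\<dots> = (\<Sum>v\<in>U. \<Sum>u\<in>fibre U c v. g u v)"
    using assms by (simp add: fibre_def sum.inter_filter)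
  finally show ?thesis .
qed

lemma sum_inverse_nfib_fibre:
  assumes "finite U" "v \<in> U"
  shows "(\<Sum>u\<in>fibre U c v. 1 / nfib U c u) = 1"
proof -
  have "(\<Sum>u\<in>fibre U c v. 1 / nfib U c u) = (\<Sum>u\<in>fibre U c v. 1 / nfib U c v)"
    by (intro sum.cong) (auto simp: nfib_eq)
  also have "\<dots> = 1"
    using nfib_pos[OF assms, of c] by (simp add: nfib_def)
  finally show ?thesis .
qed

lemma sum_fibre_average:
  assumes "finite U"
  shows "(\<Sum>u\<in>U. (\<Sum>v\<in>fibre U c u. g v) / nfib U c u) = (\<Sum>v\<in>U. g v)"
proof -
  have "(\<Sum>u\<in>U. (\<Sum>v\<in>fibre U c u. g v) / nfib U c u)
      = (\<Sum>u\<in>U. \<Sum>v\<in>fibre U c u. g v * (1 / nfib U c u))"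
    by (simp add: sum_divide_distrib)
  also have "\<dots> = (\<Sum>v\<in>U. g v * (\<Sum>u\<in>fibre U c v. 1 / nfib U c u))"
    by (subst sum_fibre_swap[OF assms]) (simp add: sum_distrib_left)
  also have "\<dots> = (\<Sum>v\<in>U. g v)"
    using assms by (intro sum.cong) (auto simp: sum_inverse_nfib_fibre)
  finally show ?thesis .
qed

text \<open>The points of one fibre carry total weight 1.\<close>

lemma sum_inverse_nfib:
  assumes "finite U"
  shows "(\<Sum>u\<in>U. 1 / nfib U c u) = card (c ` U)"
proof -
  have "(\<Sum>u\<in>U. 1 / nfib U c u) = (\<Sum>y\<in>c ` U. \<Sum>u\<in>{u\<in>U. c u = y}. 1 / nfib U c u)"
    by (rule sum.image_gen[OF assms])
  also have "\<dots> = (\<Sum>y\<in>c ` U. 1)"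
  proof (intro sum.cong refl)
    fix y assume "y \<in> c ` U"
    then obtain v where v: "v \<in> U" "y = c v" by auto
    then have "{u\<in>U. c u = y} = fibre U c v" by (auto simp: fibre_def)
    then show "(\<Sum>u\<in>{u\<in>U. c u = y}. 1 / nfib U c u) = 1"
      using sum_inverse_nfib_fibre[OF assms v(1)] by simp
  qed
  finally show ?thesis by simp
qed

text \<open>The increments of n ln n grow with n, and inserting a point enlarges its c-fibre at least
  as much as its (c,s)-fibre.\<close>
lemma sum_ln_nfib_insert:
  fixes c :: "'a \<Rightarrow> 'k"
  assumes "finite U" "a \<notin> U"
  defines "m \<equiv> real (card (fibre U c a))"
  shows "(\<Sum>u\<in>insert a U. ln (nfib (insert a U) c u))
     = (\<Sum>u\<in>U. ln (nfib U c u)) + ((m + 1) * ln (m + 1) - m * ln m)"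
proof -
  let ?V = "insert a U"
  have na: "nfib ?V c a = m + 1"
  proof -
    have "fibre ?V c a = insert a (fibre U c a)" by (auto simp: fibre_def)
    moreover have "a \<notin> fibre U c a" using assms by (simp add: fibre_def)
    ultimately show ?thesis using assms by (simp add: nfib_def m_def finite_fibre)
  qed
  have other: "nfib ?V c u = nfib U c u" if "u \<in> U" "c u \<noteq> c a" for u
  proof -
    have "fibre ?V c u = fibre U c u" using that by (auto simp: fibre_def)
    then show ?thesis by (simp add: nfib_def)
  qed
  have same: "nfib ?V c u = m + 1" "nfib U c u = m" if "c u = c a" for u
    using that na by (simp_all add: nfib_def m_def fibre_def)
  have split: "(\<Sum>u\<in>U. h u) = (\<Sum>u\<in>fibre U c a. h u) + (\<Sum>u\<in>U - fibre U c a. h u)" for h :: "'a \<Rightarrow> real"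
    using assms(1) by (subst sum.subset_diff[of "fibre U c a"]) (auto simp: fibre_def)
  have e: "(\<Sum>u\<in>U - fibre U c a. ln (nfib ?V c u)) = (\<Sum>u\<in>U - fibre U c a. ln (nfib U c u))"
    by (intro sum.cong refl arg_cong[where f = ln] other) (auto simp: fibre_def)
  have "(\<Sum>u\<in>fibre U c a. ln (nfib ?V c u)) = m * ln (m + 1)"
  proof -
    have "(\<Sum>u\<in>fibre U c a. ln (nfib ?V c u)) = (\<Sum>u\<in>fibre U c a. ln (m + 1))"
      by (intro sum.cong refl arg_cong[where f = ln] same) (auto simp: fibre_def)
    then show ?thesis by (simp add: m_def)
  qed
  moreover have "(\<Sum>u\<in>fibre U c a. ln (nfib U c u)) = m * ln m"
  proof -
    have "(\<Sum>u\<in>fibre U c a. ln (nfib U c u)) = (\<Sum>u\<in>fibre U c a. ln m)"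
      by (intro sum.cong refl arg_cong[where f = ln] same) (auto simp: fibre_def)
    then show ?thesis by (simp add: m_def)
  qed
  ultimately show ?thesis
    using assms(1,2) by (simp add: na split[of "\<lambda>u. ln (nfib ?V c u)"] split[of "\<lambda>u. ln (nfib U c u)"] e algebra_simps)
qed

lemma cond_ent_insert:
  assumes "finite U"
  shows "cond_ent U c s \<le> cond_ent (insert a U) c s"
proof (cases "a \<in> U")
  case False
  let ?m = "card (fibre U (\<lambda>v. (c v, s v)) a)" and ?n = "card (fibre U c a)"
  have "?m \<le> ?n"
    using assms by (intro card_mono) (auto simp: fibre_def)
  from diff_xlnx_mono[OF this] show ?thesis
    unfolding cond_ent_def sum_subtractf
    using sum_ln_nfib_insert[OF assms False, of c] sum_ln_nfib_insert[OF assms False, of "\<lambda>v. (c v, s v)"]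
    by linarith
qed (simp add: insert_absorb)

text \<open>Longer windows have fewer starting times; this compares the entropies over the two sets
  of starting times.\<close>

lemma cond_ent_mono:
  assumes "finite V" "U \<subseteq> V"
  shows "cond_ent U c s \<le> cond_ent V c s"
proof -
  have fU: "finite U" using assms finite_subset by blast
  have "cond_ent U c s \<le> cond_ent (U \<union> W) c s" if "finite W" for W
    using that
  proof induction
    case (insert x F)
    then show ?case using cond_ent_insert[of "U \<union> F" c s x] fU by simp
  qed simp
  from this[OF assms(1)] show ?thesis using assms(2) by (simp add: Un_absorb1)
qed

text \<open>A context matters only through the partition of \<open>U\<close> that it induces. Thus a
  window paired with the next request may be exchanged for the longer window.\<close>

lemma cond_ent_cong:
  assumes "\<And>u v. u \<in> U \<Longrightarrow> v \<in> U \<Longrightarrow> c u = c v \<longleftrightarrow> c' u = c' v"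
  shows "cond_ent U c s = cond_ent U c' s"
proof -
  have "nfib U c u = nfib U c' u" "nfib U (\<lambda>v. (c v, s v)) u = nfib U (\<lambda>v. (c' v, s v)) u" if "u \<in> U" for u
    using assms that by (auto simp: nfib_def fibre_def intro!: arg_cong[where f = card])
  then show ?thesis by (simp add: cond_ent_def)
qed

text \<open>The entropy of a variable with at most \<open>S\<close> values is at most
  \<open>ln S\<close>: compare with the uniform distribution through
  \<open>ln z <= z - 1\<close>.\<close>

lemma cond_ent_const_le:
  assumes "finite U" "card (s ` U) \<le> S" "S \<ge> 1" and c: "\<And>u. u \<in> U \<Longrightarrow> c u = c0"
  shows "cond_ent U c s \<le> card U * ln S"
proof -
  let ?k = "\<lambda>v. (c v, s v)"
  have fc: "nfib U c u = card U" if "u \<in> U" for u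
  proof -
    have "fibre U c u = U" using c that by (auto simp: fibre_def)
    then show ?thesis by (simp add: nfib_def)
  qed
  have "?k ` U = Pair c0 ` s ` U" using c by auto
  then have im: "card (?k ` U) \<le> S" using assms(2) by (simp add: card_image inj_on_def)
  have "cond_ent U c s \<le> (\<Sum>u\<in>U. ln S + ((card U / S) * (1 / nfib U ?k u) - 1))"
    unfolding cond_ent_def
  proof (rule sum_mono)
    fix u assume u: "u \<in> U"
    have pos: "nfib U ?k u > 0" "real (card U) > 0" "real S > 0"
      using nfib_pos[OF assms(1) u] fc[OF u] nfib_pos[OF assms(1) u, of c] assms(3) by auto
    have "ln (nfib U c u) - ln (nfib U ?k u) - ln S = ln ((card U / S) * (1 / nfib U ?k u))"
      using pos by (simp add: fc[OF u] ln_div ln_mult)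
    also have "\<dots> \<le> (card U / S) * (1 / nfib U ?k u) - 1"
      using pos by (intro ln_le_minus_one) simp
    finally show "ln (nfib U c u) - ln (nfib U ?k u) \<le> ln S + ((card U / S) * (1 / nfib U ?k u) - 1)"
      by simp
  qed
  also have "\<dots> = card U * ln S + (card U / S) * card (?k ` U) - card U"
    using sum_inverse_nfib[OF assms(1), of ?k]
    by (simp only: sum.distrib sum_subtractf sum_distrib_left[symmetric]) simp
  also have "\<dots> \<le> card U * ln S"
  proof -
    have "(card U / S) * card (?k ` U) \<le> (card U / S) * S"
      using im by (intro mult_left_mono) auto
    then show ?thesis using assms(3) by simp
  qed
  finally show ?thesis .
qed

section \<open>Entropy bounds on the advantage of knowing the state\<close>

text \<open>The entropy difference is the conditional mutual information of \<open>s\<close> and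
  \<open>x\<close> given \<open>c\<close>. By the Donsker-Varadhan variational principle it bounds
  the change of the mean of \<open>l * \<psi>\<close> from conditional independence to the joint
  distribution, up to the exponential moment controlled by Hoeffding's lemma. Optimising over
  \<open>l\<close> yields Pinsker's inequality.\<close>

lemma pinsker_fibres:
  fixes c :: "'a \<Rightarrow> 'k" and s :: "'a \<Rightarrow> 's" and x :: "'a \<Rightarrow> 'x" and \<psi> :: "'a \<Rightarrow> 'x \<Rightarrow> real" and l :: real
  assumes fin: "finite U" and l: "l > 0"
    and \<psi>01: "\<And>u y. 0 \<le> \<psi> u y \<and> \<psi> u y \<le> 1"
    and \<psi>: "\<And>u v. u \<in> U \<Longrightarrow> v \<in> U \<Longrightarrow> c u = c v \<Longrightarrow> s u = s v \<Longrightarrow> \<psi> u = \<psi> v"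
  shows "l * ((\<Sum>u\<in>U. \<psi> u (x u)) - mix_gain U c (\<lambda>u v. \<psi> u (x v)))
     \<le> cond_ent U c s - cond_ent U (\<lambda>u. (c u, x u)) s + card U * l\<^sup>2 / 8"
proof -
  let ?cs = "\<lambda>v. (c v, s v)" and ?cx = "\<lambda>v. (c v, x v)" and ?cxs = "\<lambda>v. ((c v, x v), s v)"
  define av where "av u = (\<Sum>v\<in>fibre U c u. \<psi> u (x v)) / nfib U c u" for u
  \<comment> \<open>Normalised so that the average of \<open>exp (\<theta> u (x v))\<close> over
    \<open>v\<close> in the \<open>c\<close>-fibre of \<open>u\<close> is at most 1.\<close>
  define \<theta> where "\<theta> u y = l * (\<psi> u y - av u) - l\<^sup>2 / 8" for u y
  \<comment> \<open>The likelihood ratio of \<open>(s u, x u)\<close> given \<open>c u\<close>: the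
    product of the conditional marginals over the joint probability.\<close>
  define r where "r u = nfib U ?cs u * nfib U ?cx u / (nfib U c u * nfib U ?cxs u)" for u
  have pos: "nfib U c u > 0" "nfib U ?cs u > 0" "nfib U ?cx u > 0" "nfib U ?cxs u > 0" if "u \<in> U" for u
    using nfib_pos[OF fin that] by auto
  have av_eq: "av u = av v" if "u \<in> U" "v \<in> U" "c u = c v" "s u = s v" for u v
  proof -
    have "u \<in> fibre U c v" using that by (simp add: fibre_def)
    then show ?thesis using \<psi>[OF that] by (simp add: av_def fibre_eq nfib_eq)
  qed
  have \<theta>_eq: "\<theta> u = \<theta> v" if "u \<in> U" "v \<in> U" "c u = c v" "s u = s v" for u v
    using \<psi>[OF that] av_eq[OF that] by (simp add: \<theta>_def fun_eq_iff)
  have hoeff: "(\<Sum>v\<in>fibre U c u. exp (\<theta> u (x v))) \<le> nfib U c u" if "u \<in> U" for u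
  proof -
    have "fibre U c u \<noteq> {}" using that by (auto simp: fibre_def)
    then have "(\<Sum>v\<in>fibre U c u. exp (l * (\<psi> u (x v) - (\<Sum>w\<in>fibre U c u. \<psi> u (x w)) / card (fibre U c u)) - l\<^sup>2 / 8))
        \<le> card (fibre U c u)"
      using \<psi>01 l by (intro hoeffding_sum finite_fibre[OF fin]) auto
    then show ?thesis by (simp add: \<theta>_def av_def nfib_def)
  qed
  \<comment> \<open>The factor \<open>nfib U ?cx u\<close> of \<open>r u\<close> is written out as a
    sum over its fibre, so that the order of summation can be exchanged.\<close>
  have "(\<Sum>u\<in>U. exp (\<theta> u (x u)) * r u)
      = (\<Sum>u\<in>U. \<Sum>v\<in>fibre U ?cx u. exp (\<theta> u (x v)) * nfib U ?cs u / (nfib U c u * nfib U ?cxs u))"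
  proof (rule sum.cong[OF refl])
    fix u assume "u \<in> U"
    have "(\<Sum>v\<in>fibre U ?cx u. exp (\<theta> u (x v)) * nfib U ?cs u / (nfib U c u * nfib U ?cxs u))
        = (\<Sum>v\<in>fibre U ?cx u. exp (\<theta> u (x u)) * nfib U ?cs u / (nfib U c u * nfib U ?cxs u))"
      by (intro sum.cong) (auto simp: fibre_def)
    then show "exp (\<theta> u (x u)) * r u
        = (\<Sum>v\<in>fibre U ?cx u. exp (\<theta> u (x v)) * nfib U ?cs u / (nfib U c u * nfib U ?cxs u))"
      by (simp add: r_def nfib_def)
  qed
  also have "\<dots> = (\<Sum>v\<in>U. \<Sum>u\<in>fibre U ?cx v. exp (\<theta> u (x v)) * nfib U ?cs u / (nfib U c u * nfib U ?cxs u))"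
    by (rule sum_fibre_swap[OF fin])
  also have "\<dots> \<le> (\<Sum>v\<in>U. \<Sum>w\<in>fibre U c v. exp (\<theta> w (x v)) / nfib U c w)"
  proof (rule sum_mono)
    fix v assume v: "v \<in> U"
    define F where "F = fibre U ?cx v"
    define h where "h w = exp (\<theta> w (x v)) / nfib U c w" for w
    have fF: "finite F" using fin by (simp add: F_def finite_fibre)
    have FU: "F \<subseteq> U" by (auto simp: F_def fibre_def)
    \<comment> \<open>Since \<open>h\<close> depends on a point only through its context and state,
      the factor \<open>nfib U ?cs u\<close> becomes a sum of \<open>h w\<close> over the points
      \<open>w\<close> sharing both with \<open>u\<close>.\<close>
    have inner: "(\<Sum>w\<in>fibre U ?cs u. if w \<in> fibre U c v then h w else 0) = h u * nfib U ?cs u" if "u \<in> F" for u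
    proof -
      have "(\<Sum>w\<in>fibre U ?cs u. if w \<in> fibre U c v then h w else 0) = (\<Sum>w\<in>fibre U ?cs u. h u)"
      proof (rule sum.cong[OF refl])
        fix w assume "w \<in> fibre U ?cs u"
        then have w: "w \<in> U" "c w = c u" "s w = s u" by (auto simp: fibre_def)
        have u: "u \<in> U" "c u = c v" using that by (auto simp: F_def fibre_def)
        have "w \<in> fibre U c u" using w by (simp add: fibre_def)
        then have "h w = h u" using \<theta>_eq[of w u] w u by (simp add: h_def nfib_eq)
        then show "(if w \<in> fibre U c v then h w else 0) = h u" using w u by (simp add: fibre_def)
      qed
      then show ?thesis by (simp add: nfib_def)
    qed
    have "(\<Sum>u\<in>F. exp (\<theta> u (x v)) * nfib U ?cs u / (nfib U c u * nfib U ?cxs u))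
        = (\<Sum>u\<in>F. (h u * nfib U ?cs u) * (1 / nfib U ?cxs u))"
      by (simp add: h_def)
    also have "\<dots> = (\<Sum>u\<in>F. \<Sum>w\<in>fibre U ?cs u. (if w \<in> fibre U c v then h w else 0) * (1 / nfib U ?cxs u))"
      by (intro sum.cong refl) (simp only: inner[symmetric] sum_distrib_right)
    also have "\<dots> = (\<Sum>u\<in>F. \<Sum>w\<in>U. if ?cs w = ?cs u then (if w \<in> fibre U c v then h w else 0) * (1 / nfib U ?cxs u) else 0)"
      unfolding fibre_def[of U ?cs] using fin by (simp only: sum.inter_filter)
    also have "\<dots> = (\<Sum>w\<in>U. \<Sum>u\<in>F. if ?cs w = ?cs u then (if w \<in> fibre U c v then h w else 0) * (1 / nfib U ?cxs u) else 0)"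
      by (rule sum.swap)
    also have "\<dots> \<le> (\<Sum>w\<in>U. if w \<in> fibre U c v then h w else 0)"
    proof (rule sum_mono)
      fix w assume w: "w \<in> U"
      have h0: "h w \<ge> 0" using pos[OF w] by (simp add: h_def)
      \<comment> \<open>The sum is 1 if the state of \<open>w\<close> occurs together with the
        outcome of \<open>v\<close> in this context, and 0 otherwise. Combinations that never occur
        make the estimate an inequality.\<close>
      have "(\<Sum>u\<in>F. if ?cs w = ?cs u then 1 / nfib U ?cxs u else 0) \<le> 1"
      proof (cases "\<exists>u0\<in>F. ?cs w = ?cs u0")
        case True
        then obtain u0 where u0: "u0 \<in> F" "?cs w = ?cs u0" by blast
        have "u \<in> F \<and> ?cs w = ?cs u \<longleftrightarrow> u \<in> fibre U ?cxs u0" for u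
          using u0 unfolding F_def fibre_def mem_Collect_eq prod.inject by metis
        then have "{u\<in>F. ?cs w = ?cs u} = fibre U ?cxs u0" by blast
        moreover have "(\<Sum>u\<in>fibre U ?cxs u0. 1 / nfib U ?cxs u) = 1"
          using u0(1) FU by (intro sum_inverse_nfib_fibre[OF fin]) blast
        ultimately show ?thesis
          by (simp only: sum.inter_filter[OF fF, symmetric])
      next
        case False
        then have "(\<Sum>u\<in>F. if ?cs w = ?cs u then 1 / nfib U ?cxs u else 0) = 0"
          by (intro sum.neutral) auto
        then show ?thesis by simp
      qed
      then have "h w * (\<Sum>u\<in>F. if ?cs w = ?cs u then 1 / nfib U ?cxs u else 0) \<le> h w"
        using h0 mult_left_mono by fastforce
      moreover have "(\<Sum>u\<in>F. if ?cs w = ?cs u then h w * (1 / nfib U ?cxs u) else 0)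
          = h w * (\<Sum>u\<in>F. if ?cs w = ?cs u then 1 / nfib U ?cxs u else 0)"
        by (simp only: sum_distrib_left) (intro sum.cong, auto)
      ultimately show "(\<Sum>u\<in>F. if ?cs w = ?cs u then (if w \<in> fibre U c v then h w else 0) * (1 / nfib U ?cxs u) else 0)
        \<le> (if w \<in> fibre U c v then h w else 0)"
        by (cases "w \<in> fibre U c v") (simp_all cong: if_cong)
    qed
    also have "\<dots> = (\<Sum>w\<in>{w\<in>U. w \<in> fibre U c v}. h w)"
      using fin by (simp only: sum.inter_filter)
    also have "{w\<in>U. w \<in> fibre U c v} = fibre U c v" by (auto simp: fibre_def)
    finally show "(\<Sum>u\<in>fibre U ?cx v. exp (\<theta> u (x v)) * nfib U ?cs u / (nfib U c u * nfib U ?cxs u))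
      \<le> (\<Sum>w\<in>fibre U c v. exp (\<theta> w (x v)) / nfib U c w)"
      by (simp add: F_def h_def)
  qed
  also have "\<dots> = (\<Sum>w\<in>U. (\<Sum>v\<in>fibre U c w. exp (\<theta> w (x v))) / nfib U c w)"
    by (subst sum_fibre_swap[OF fin]) (simp add: sum_divide_distrib)
  also have "\<dots> \<le> (\<Sum>w\<in>U. 1)"
    using hoeff pos by (intro sum_mono) (simp add: divide_le_eq)
  finally have key: "(\<Sum>u\<in>U. exp (\<theta> u (x u)) * r u) \<le> card U" by simp
  have "(\<Sum>u\<in>U. \<theta> u (x u) + ln (r u)) \<le> (\<Sum>u\<in>U. exp (\<theta> u (x u)) * r u - 1)"
  proof (rule sum_mono)
    fix u assume u: "u \<in> U"
    have r: "r u > 0" using pos[OF u] by (simp add: r_def)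
    then have "\<theta> u (x u) + ln (r u) = ln (exp (\<theta> u (x u)) * r u)" by (simp add: ln_mult)
    also have "\<dots> \<le> exp (\<theta> u (x u)) * r u - 1" using r by (intro ln_le_minus_one) simp
    finally show "\<theta> u (x u) + ln (r u) \<le> exp (\<theta> u (x u)) * r u - 1" .
  qed
  also have "\<dots> \<le> 0" using key by (simp add: sum_subtractf)
  finally have "(\<Sum>u\<in>U. \<theta> u (x u)) + (\<Sum>u\<in>U. ln (r u)) \<le> 0" by (simp add: sum.distrib)
  moreover have "(\<Sum>u\<in>U. ln (r u)) = cond_ent U ?cx s - cond_ent U c s"
  proof -
    have "ln (r u) = ln (nfib U ?cx u) - ln (nfib U ?cxs u) - (ln (nfib U c u) - ln (nfib U ?cs u))"
      if "u \<in> U" for u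
      using pos[OF that] by (simp add: r_def ln_div ln_mult)
    then show ?thesis by (simp add: cond_ent_def sum_subtractf)
  qed
  moreover have "(\<Sum>u\<in>U. \<theta> u (x u))
      = l * ((\<Sum>u\<in>U. \<psi> u (x u)) - mix_gain U c (\<lambda>u v. \<psi> u (x v))) - card U * l\<^sup>2 / 8"
    unfolding \<theta>_def mix_gain_def av_def[symmetric]
    by (simp only: sum_subtractf sum_distrib_left[symmetric]) simp
  ultimately show ?thesis by linarith
qed

text \<open>The randomized predictor that first draws the state from its conditional distribution given
  the context earns the whole reward whenever the drawn state is the true one.\<close>
lemma imitation_fibres:
  fixes c :: "'a \<Rightarrow> 'k" and s :: "'a \<Rightarrow> 's" and x :: "'a \<Rightarrow> 'x" and \<psi> :: "'a \<Rightarrow> 'x \<Rightarrow> real" and D :: real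
  assumes fin: "finite U" and ne: "U \<noteq> {}"
    and \<psi>01: "\<And>u y. 0 \<le> \<psi> u y \<and> \<psi> u y \<le> 1"
    and \<psi>: "\<And>u v. u \<in> U \<Longrightarrow> v \<in> U \<Longrightarrow> c u = c v \<Longrightarrow> s u = s v \<Longrightarrow> \<psi> u = \<psi> v"
    and D: "D \<le> (\<Sum>u\<in>U. \<psi> u (x u)) - mix_gain U c (\<lambda>u v. \<psi> u (x v))"
  shows "D < card U" "card U * ln (card U / (card U - D)) \<le> cond_ent U c s"
proof -
  let ?cs = "\<lambda>v. (c v, s v)"
  \<comment> \<open>The conditional probability of the true state given the context, that is, the
    chance that the imitator draws it.\<close>
  define \<rho> where "\<rho> u = nfib U ?cs u / nfib U c u" for u
  define n where "n = real (card U)"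
  have n: "n > 0" using fin ne by (simp add: n_def card_gt_0_iff)
  have pos: "nfib U c u > 0" "nfib U ?cs u > 0" if "u \<in> U" for u
    using nfib_pos[OF fin that] by auto
  have \<rho>: "\<rho> u > 0" "\<rho> u \<le> 1" if "u \<in> U" for u
    using pos[OF that] nfib_mono[OF fin, of ?cs u c] by (auto simp: \<rho>_def)
  \<comment> \<open>Each summand is spread evenly over its fibre of context and state. After the
    exchange of sums these fibres lie inside the \<open>c\<close>-fibres that
    \<open>mix_gain\<close> averages over.\<close>
  have "(\<Sum>u\<in>U. \<psi> u (x u) * \<rho> u)
      = (\<Sum>u\<in>U. (\<Sum>v\<in>fibre U ?cs u. \<psi> u (x u) * \<rho> u) / nfib U ?cs u)"
    using pos by (intro sum.cong refl) (force simp: nfib_def)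
  also have "\<dots> = (\<Sum>u\<in>U. \<Sum>v\<in>fibre U ?cs u. \<psi> u (x u) * \<rho> u / nfib U ?cs u)"
    by (simp add: sum_divide_distrib)
  also have "\<dots> = (\<Sum>v\<in>U. \<Sum>u\<in>fibre U ?cs v. \<psi> u (x u) * \<rho> u / nfib U ?cs u)"
    by (rule sum_fibre_swap[OF fin])
  also have "\<dots> \<le> (\<Sum>v\<in>U. \<Sum>u\<in>fibre U c v. \<psi> v (x u) / nfib U c v)"
  proof (rule sum_mono)
    fix v assume v: "v \<in> U"
    have "(\<Sum>u\<in>fibre U ?cs v. \<psi> u (x u) * \<rho> u / nfib U ?cs u)
        = (\<Sum>u\<in>fibre U ?cs v. \<psi> v (x u) / nfib U c v)"
    proof (rule sum.cong[OF refl])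
      fix u assume u: "u \<in> fibre U ?cs v"
      then have u': "u \<in> U" "c u = c v" "s u = s v" by (auto simp: fibre_def)
      then have "nfib U c u = nfib U c v" by (intro nfib_eq) (simp add: fibre_def)
      then show "\<psi> u (x u) * \<rho> u / nfib U ?cs u = \<psi> v (x u) / nfib U c v"
        using \<psi>[OF u'(1) v u'(2,3)] pos[OF u'(1)] by (simp add: \<rho>_def)
    qed
    also have "\<dots> \<le> (\<Sum>u\<in>fibre U c v. \<psi> v (x u) / nfib U c v)"
      using fin \<psi>01 pos[OF v] by (intro sum_mono2) (auto simp: fibre_def)
    finally show "(\<Sum>u\<in>fibre U ?cs v. \<psi> u (x u) * \<rho> u / nfib U ?cs u)
        \<le> (\<Sum>u\<in>fibre U c v. \<psi> v (x u) / nfib U c v)" .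
  qed
  also have "\<dots> = mix_gain U c (\<lambda>u v. \<psi> u (x v))"
    by (simp add: mix_gain_def sum_divide_distrib)
  finally have "D \<le> (\<Sum>u\<in>U. \<psi> u (x u) * (1 - \<rho> u))"
    using D by (simp add: algebra_simps sum_subtractf)
  also have "\<dots> \<le> (\<Sum>u\<in>U. 1 * (1 - \<rho> u))"
    using \<rho> \<psi>01 by (intro sum_mono mult_right_mono) auto
  finally have le: "(\<Sum>u\<in>U. \<rho> u) \<le> n - D" by (simp add: sum_subtractf n_def)
  moreover have "(\<Sum>u\<in>U. \<rho> u) > 0" using \<rho> fin ne by (intro sum_pos) auto
  ultimately have nD: "n - D > 0" by linarith
  then show "D < card U" by (simp add: n_def)
  define a where "a = (n - D) / n"
  have a: "a > 0" using n nD by (simp add: a_def)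
  \<comment> \<open>Jensen's inequality through the tangent of \<open>ln\<close> at
    \<open>a\<close>, an upper bound for the mean of \<open>\<rho>\<close>.\<close>
  have "(\<Sum>u\<in>U. ln (\<rho> u)) \<le> (\<Sum>u\<in>U. ln a + (\<rho> u / a - 1))"
  proof (rule sum_mono)
    fix u assume u: "u \<in> U"
    have "ln (\<rho> u / a) \<le> \<rho> u / a - 1" using \<rho>[OF u] a by (intro ln_le_minus_one) simp
    then show "ln (\<rho> u) \<le> ln a + (\<rho> u / a - 1)" using \<rho>[OF u] a by (simp add: ln_div)
  qed
  also have "\<dots> = n * ln a + (\<Sum>u\<in>U. \<rho> u) / a - n"
    by (simp add: sum.distrib sum_subtractf n_def sum_divide_distrib)
  also have "\<dots> \<le> n * ln a + (n - D) / a - n"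
    using le a by (simp add: divide_right_mono)
  also have "\<dots> = n * ln a" using n nD by (simp add: a_def)
  finally have "- (n * ln a) \<le> - (\<Sum>u\<in>U. ln (\<rho> u))" by simp
  also have "- (\<Sum>u\<in>U. ln (\<rho> u)) = (\<Sum>u\<in>U. - ln (\<rho> u))" by (simp add: sum_negf)
  also have "\<dots> = cond_ent U c s"
    unfolding cond_ent_def
  proof (rule sum.cong[OF refl])
    fix u assume "u \<in> U"
    from pos[OF this] show "- ln (\<rho> u) = ln (nfib U c u) - ln (nfib U ?cs u)"
      by (simp add: \<rho>_def ln_div)
  qed
  also have "- (n * ln a) = n * ln (n / (n - D))"
    using n nD by (simp add: a_def ln_div algebra_simps)
  finally show "card U * ln (card U / (card U - D)) \<le> cond_ent U c s" by (simp add: n_def)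
qed

subsection \<open>Finite state prefetchers against Markov prefetchers\<close>

lemma hit_prob_bounds: "0 \<le> hit_prob D x" "hit_prob D x \<le> 1"
  by (simp_all add: hit_prob_def)

text \<open>The state at the start of a window and the window itself determine the state at its end,
  hence the next decision. This provides the hypothesis on \<open>\<psi>\<close> in the entropy
  lemmas.\<close>

lemma fsp_state_add:
  assumes "u + j \<le> length xs"
  shows "fsp_state g s0 xs (u + j) = foldl g (fsp_state g s0 xs u) (take j (drop u xs))"
  using assms
proof (induction j)
  case (Suc j)
  then show ?case by (simp add: take_Suc_conv_app_nth)
qed simp

lemma fsp_state_in:
  assumes "is_FSP N C Q g f s0" "valid_seq N xs" "t \<le> length xs"
  shows "fsp_state g s0 xs t \<in> Q"
  using assms(3)
proof (induction t)
  case 0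
  then show ?case using assms(1) by (simp add: is_FSP_def)
next
  case (Suc t)
  then have "xs ! t \<in> files N" using assms(2) by (auto simp: valid_seq_def)
  then show ?case using Suc assms(1) by (simp add: is_FSP_def)
qed

text \<open>A Markov state lists the latest request first, hence the \<open>rev\<close>. The window
  starts at time 0 or later, so it lies inside \<open>xs\<close>.\<close>

lemma take_markov_state:
  assumes "j \<le> length pre" "u + j \<le> length xs"
  shows "take j (markov_state pre xs (u + j)) = rev (take j (drop u xs))"
proof -
  have "take (u + j) xs = take u xs @ take j (drop u xs)"
    by (simp add: take_add)
  moreover have "length (take j (drop u xs)) = j"
    using assms(2) by simp
  ultimately show ?thesis
    using assms(1) by (simp add: markov_state_def min_def del: length_take length_drop)
qed

section \<open>Lower bounds on the hits of the best Markov prefetcher\<close>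

lemma markov_misses_nonneg: "0 \<le> markov_misses pre f xs"
  unfolding markov_misses_def by (intro sum_nonneg) (simp add: hit_prob_bounds)

lemma markov_Lstar_le:
  assumes "\<And>s. set_pmf (f s) \<subseteq> csets N C"
  shows "markov_Lstar N C pre xs \<le> markov_misses pre f xs"
  unfolding markov_Lstar_def
proof (rule cINF_lower)
  show "bdd_below ((\<lambda>f. markov_misses pre f xs) ` {f. \<forall>s. set_pmf (f s) \<subseteq> csets N C})"
    by (rule bdd_belowI2[where m = 0]) (rule markov_misses_nonneg)
qed (use assms in simp)

lemma markov_misses_eq:
  "markov_misses pre f xs = real (length xs) - (\<Sum>t<length xs. hit_prob (f (markov_state pre xs t)) (xs ! t))"
  by (simp add: markov_misses_def sum_subtractf)

text \<open>In \<open>mix_gain\<close> every decision is scored on the whole fibre of its window.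
  Replacing it by the best decision found in that fibre loses nothing and makes it a function of the
  last \<open>j\<close> requests, hence a Markov prefetcher of order \<open>k\<close>.\<close>

lemma markov_Lstar_le_mix:
  fixes j :: nat and \<mu> :: "nat \<Rightarrow> nat set pmf"
  assumes j: "j \<le> length pre" "j < length xs"
    and \<mu>: "\<And>t. t < length xs \<Longrightarrow> set_pmf (\<mu> t) \<subseteq> csets N C"
  defines "U \<equiv> {..<length xs - j}" and "c \<equiv> \<lambda>u. take j (drop u xs)"
  shows "mix_gain U c (\<lambda>u v. hit_prob (\<mu> (u + j)) (xs ! (v + j))) \<le> real (length xs) - markov_Lstar N C pre xs"
proof -
  let ?h = "\<lambda>u v. hit_prob (\<mu> (u + j)) (xs ! (v + j))"
  have fin: "finite U" by (simp add: U_def)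
  have best: "\<exists>w\<in>U. \<forall>u\<in>fibre U c v. (\<Sum>z\<in>fibre U c v. ?h u z) \<le> (\<Sum>z\<in>fibre U c v. ?h w z)" if v: "v \<in> U" for v
  proof -
    let ?M = "(\<lambda>u. \<Sum>z\<in>fibre U c v. ?h u z) ` fibre U c v"
    have "finite ?M" "?M \<noteq> {}" using v fin by (auto simp: fibre_def)
    then have "Max ?M \<in> ?M" by (rule Max_in)
    then obtain w where "w \<in> fibre U c v" "Max ?M = (\<Sum>z\<in>fibre U c v. ?h w z)" by auto
    moreover have "\<forall>u\<in>fibre U c v. (\<Sum>z\<in>fibre U c v. ?h u z) \<le> Max ?M"
      using \<open>finite ?M\<close> by auto
    ultimately show ?thesis by (auto simp: fibre_def)
  qed
  have "\<exists>w. w \<in> U \<and> (\<forall>u\<in>U. c u = y \<longrightarrow>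
      (\<Sum>z\<in>{v\<in>U. c v = y}. ?h u z) \<le> (\<Sum>z\<in>{v\<in>U. c v = y}. ?h w z))" for y
  proof (cases "y \<in> c ` U")
    case True
    then obtain v where "v \<in> U" "y = c v" by blast
    with best[of v] show ?thesis by (auto simp: fibre_def)
  next
    case False
    \<comment> \<open>Windows that never occur receive the arbitrary representative 0, so that
      \<open>F\<close> is a legal decision at every state.\<close>
    moreover have "0 \<in> U" using j(2) by (simp add: U_def)
    ultimately show ?thesis by blast
  qed
  then have "\<forall>y. \<exists>w. w \<in> U \<and> (\<forall>u\<in>U. c u = y \<longrightarrow>
      (\<Sum>z\<in>{v\<in>U. c v = y}. ?h u z) \<le> (\<Sum>z\<in>{v\<in>U. c v = y}. ?h w z))" ..
  from choice[OF this] obtain w where wU: "\<And>y. w y \<in> U" and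
    w: "\<And>y u. u \<in> U \<Longrightarrow> c u = y \<Longrightarrow>
      (\<Sum>z\<in>{v\<in>U. c v = y}. ?h u z) \<le> (\<Sum>z\<in>{v\<in>U. c v = y}. ?h (w y) z)"
    by blast
  define F where "F st = \<mu> (w (rev (take j st)) + j)" for st
  have F: "set_pmf (F st) \<subseteq> csets N C" for st
    unfolding F_def using wU[of "rev (take j st)"] by (intro \<mu>) (auto simp: U_def)
  have "mix_gain U c ?h \<le> (\<Sum>u\<in>U. (\<Sum>v\<in>fibre U c u. ?h (w (c v)) v) / nfib U c u)"
    unfolding mix_gain_def
  proof (rule sum_mono, rule divide_right_mono)
    fix u assume u: "u \<in> U"
    have "(\<Sum>v\<in>fibre U c u. ?h u v) \<le> (\<Sum>v\<in>fibre U c u. ?h (w (c u)) v)"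
      using w[OF u refl] by (simp add: fibre_def)
    also have "\<dots> = (\<Sum>v\<in>fibre U c u. ?h (w (c v)) v)"
      by (intro sum.cong) (auto simp: fibre_def)
    finally show "(\<Sum>v\<in>fibre U c u. ?h u v) \<le> (\<Sum>v\<in>fibre U c u. ?h (w (c v)) v)" .
  qed (simp add: nfib_def)
  also have "\<dots> = (\<Sum>v\<in>U. ?h (w (c v)) v)"
    by (rule sum_fibre_average[OF fin])
  also have "\<dots> = (\<Sum>v\<in>U. hit_prob (F (markov_state pre xs (v + j))) (xs ! (v + j)))"
    by (intro sum.cong refl) (use j in \<open>auto simp: F_def U_def c_def take_markov_state\<close>)
  also have "\<dots> = (\<Sum>t\<in>(\<lambda>v. v + j) ` U. hit_prob (F (markov_state pre xs t)) (xs ! t))"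
    by (subst sum.reindex) (auto simp: inj_on_def)
  \<comment> \<open>The first \<open>j\<close> rounds, missing on the left, contribute nonnegative
    hit probabilities.\<close>
  also have "\<dots> \<le> (\<Sum>t<length xs. hit_prob (F (markov_state pre xs t)) (xs ! t))"
    by (intro sum_mono2) (auto simp: U_def hit_prob_bounds)
  also have "\<dots> = real (length xs) - markov_misses pre F xs"
    by (simp add: markov_misses_eq)
  also have "\<dots> \<le> real (length xs) - markov_Lstar N C pre xs"
    using markov_Lstar_le[OF F] by simp
  finally show ?thesis .
qed

section \<open>The entropy chain along growing windows\<close>

text \<open>The first two bounds are imitation with empty windows. For the third, the Pinsker steps
  telescope from \<open>E 0\<close> down to \<open>E k\<close>, and imitation bounds
  \<open>E k\<close> below; \<open>k <= G\<close> keeps the advantages \<open>G - j\<close> positive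
  for \<open>j < k\<close>.\<close>

lemma fsp_entropy_chain:
  fixes T k S :: nat and G :: real
  assumes fsp: "is_FSP N C Q g f s0" "card Q \<le> S" and S: "S \<ge> 1"
    and xs: "valid_seq N xs" "length xs = T" and k: "length pre = k" "k < T"
  defines "G \<equiv> (\<Sum>t<T. hit_prob (f (fsp_state g s0 xs t)) (xs ! t)) - (real T - markov_Lstar N C pre xs)"
  shows "G < T" "T * ln (T / (T - G)) \<le> T * ln S"
    and "k \<le> G \<Longrightarrow> (\<Sum>j<k. 2 * (G - j)\<^sup>2 / (real T - j)) + (real T - k) * ln ((real T - k) / (T - G)) \<le> T * ln S"
proof -
  define s where "s = fsp_state g s0 xs"
  define h where "h t = hit_prob (f (s t)) (xs ! t)" for t
  define U where "U j = {..<T - j}" for j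
  define c where "c j u = take j (drop u xs)" for j u
  define \<psi> where "\<psi> j u y = hit_prob (f (s (u + j))) y" for j u y
  define E where "E j = cond_ent (U j) (c j) s" for j
  have fin: "finite (U j)" for j by (simp add: U_def)
  have card: "real (card (U j)) = real T - j" if "j \<le> k" for j
    using that k by (simp add: U_def of_nat_diff)
  have ne: "U j \<noteq> {}" if "j \<le> k" for j using that k by (simp add: U_def lessThan_empty_iff)
  have \<psi>01: "0 \<le> \<psi> j u y \<and> \<psi> j u y \<le> 1" for j u y
    by (simp add: \<psi>_def hit_prob_bounds)
  have \<psi>eq: "\<psi> j u = \<psi> j v" if "j \<le> k" "u \<in> U j" "v \<in> U j" "c j u = c j v" "s u = s v" for j u v
  proof -
    have "s (u + j) = s (v + j)"
      using that k xs unfolding s_def c_def U_def by (subst (1 2) fsp_state_add) auto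
    then show ?thesis by (simp add: \<psi>_def fun_eq_iff)
  qed
  \<comment> \<open>The first \<open>j\<close> rounds end no complete window; dropping them costs at
    most \<open>j\<close> hits.\<close>
  have gain: "G - j \<le> (\<Sum>u\<in>U j. \<psi> j u (xs ! (u + j))) - mix_gain (U j) (c j) (\<lambda>u v. \<psi> j u (xs ! (v + j)))"
    if j: "j \<le> k" for j
  proof -
    have "set_pmf (f (s t)) \<subseteq> csets N C" if "t < T" for t
      using fsp(1) fsp_state_in[OF fsp(1) xs(1), of t] xs that by (simp add: is_FSP_def s_def)
    then have "mix_gain (U j) (c j) (\<lambda>u v. \<psi> j u (xs ! (v + j))) \<le> real T - markov_Lstar N C pre xs"
      using markov_Lstar_le_mix[of j pre xs "\<lambda>t. f (s t)" N C] j k xs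
      unfolding \<psi>_def U_def c_def by simp
    moreover have "(\<Sum>t<T. h t) \<le> (\<Sum>u\<in>U j. \<psi> j u (xs ! (u + j))) + j"
    proof -
      have "(\<Sum>t<T. h t) = (\<Sum>t\<in>(\<lambda>u. u + j) ` U j \<union> {..<j}. h t)"
      proof (rule sum.cong)
        show "{..<T} = (\<lambda>u. u + j) ` U j \<union> {..<j}"
        proof (intro equalityI subsetI)
          fix t assume "t \<in> {..<T}"
          then show "t \<in> (\<lambda>u. u + j) ` U j \<union> {..<j}"
            by (cases "t < j") (auto simp: U_def intro!: image_eqI[of _ _ "t - j"])
        qed (use j k in \<open>auto simp: U_def\<close>)
      qed simp
      also have "\<dots> = (\<Sum>t\<in>(\<lambda>u. u + j) ` U j. h t) + (\<Sum>t<j. h t)"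
        by (intro sum.union_disjoint) (auto simp: U_def)
      also have "(\<Sum>t\<in>(\<lambda>u. u + j) ` U j. h t) = (\<Sum>u\<in>U j. \<psi> j u (xs ! (u + j)))"
        by (subst sum.reindex) (auto simp: h_def \<psi>_def inj_on_def)
      also have "(\<Sum>t<j. h t) \<le> (\<Sum>t<j. 1)"
        by (intro sum_mono) (simp add: h_def hit_prob_bounds)
      finally show ?thesis by simp
    qed
    ultimately show ?thesis by (simp add: G_def h_def s_def)
  qed
  have imit: "G - j < card (U j)" "card (U j) * ln (card (U j) / (card (U j) - (G - j))) \<le> E j" if "j \<le> k" for j
    unfolding E_def by (rule imitation_fibres[OF fin ne[OF that] \<psi>01 \<psi>eq[OF that] gain[OF that]]; assumption)+
  have E0: "E 0 \<le> T * ln S"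
  proof -
    have "s ` U 0 \<subseteq> Q" using fsp_state_in[OF fsp(1) xs(1)] xs by (auto simp: U_def s_def)
    then have "card (s ` U 0) \<le> S"
      using fsp card_mono[of Q "s ` U 0"] by (simp add: is_FSP_def)
    from cond_ent_const_le[OF fin this S, of "c 0" "[]"] show ?thesis
      by (simp add: E_def c_def card[of 0, simplified])
  qed
  show "G < T" using imit(1)[of 0] by (simp add: U_def)
  show "T * ln (T / (T - G)) \<le> T * ln S" using imit(2)[of 0] E0 by (simp add: U_def)
  assume kG: "k \<le> G"
  have step: "2 * (G - j)\<^sup>2 / (real T - j) \<le> E j - E (Suc j)" if j: "j < k" for j
  proof -
    define n where "n = real T - j"
    have n: "n > 0" using j k by (simp add: n_def)
    \<comment> \<open>The maximiser of \<open>l * (G - j) - n * l^2 / 8\<close>; the maximum is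
      \<open>2 * (G - j)^2 / n\<close>.\<close>
    define l where "l = 4 * (G - j) / n"
    have l: "l > 0" using j kG n by (simp add: l_def)
    have "l * (G - j) \<le> l * ((\<Sum>u\<in>U j. \<psi> j u (xs ! (u + j))) - mix_gain (U j) (c j) (\<lambda>u v. \<psi> j u (xs ! (v + j))))"
      using gain[of j] j l by (intro mult_left_mono) auto
    also have "\<dots> \<le> E j - cond_ent (U j) (\<lambda>u. (c j u, xs ! (u + j))) s + card (U j) * l\<^sup>2 / 8"
      unfolding E_def using j by (intro pinsker_fibres fin l \<psi>01 \<psi>eq) auto
    also have "cond_ent (U j) (\<lambda>u. (c j u, xs ! (u + j))) s = cond_ent (U j) (c (Suc j)) s"
    proof (rule cond_ent_cong)
      have app: "c (Suc j) u = c j u @ [xs ! (u + j)]" if "u \<in> U j" for u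
        using that xs by (simp add: c_def U_def take_Suc_conv_app_nth)
      fix u v assume "u \<in> U j" "v \<in> U j"
      then show "(c j u, xs ! (u + j)) = (c j v, xs ! (v + j)) \<longleftrightarrow> c (Suc j) u = c (Suc j) v"
        by (simp add: app)
    qed
    also have "card (U j) * l\<^sup>2 / 8 = 2 * (G - j)\<^sup>2 / n"
    proof -
      have "n * (4 * a / n)\<^sup>2 / 8 = 2 * a\<^sup>2 / n" for a
        using n by (simp add: power2_eq_square field_simps)
      then show ?thesis
        unfolding l_def card[OF less_imp_le[OF j]] n_def[symmetric] .
    qed
    finally have "l * (G - j) \<le> E j - cond_ent (U j) (c (Suc j)) s + 2 * (G - j)\<^sup>2 / n" .
    moreover have "E (Suc j) \<le> cond_ent (U j) (c (Suc j)) s"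
      unfolding E_def by (rule cond_ent_mono) (auto simp: U_def)
    moreover have "l * (G - j) = 2 * (G - j)\<^sup>2 / n + 2 * (G - j)\<^sup>2 / n"
      by (simp add: l_def power2_eq_square)
    ultimately show ?thesis by (simp add: n_def)
  qed
  have "(\<Sum>j<k. 2 * (G - j)\<^sup>2 / (real T - j)) \<le> (\<Sum>j<k. E j - E (Suc j))"
    using step by (intro sum_mono) auto
  also have "\<dots> = E 0 - E k" by (induction k) simp_all
  \<comment> \<open>At level \<open>k\<close> there are \<open>T - k\<close> windows, and
    subtracting the advantage \<open>G - k\<close> leaves \<open>T - G\<close> inside the
    logarithm.\<close>
  finally show "(\<Sum>j<k. 2 * (G - j)\<^sup>2 / (real T - j)) + (real T - k) * ln ((real T - k) / (T - G)) \<le> T * ln S"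
    using E0 imit(2)[of k] card[of k] by simp
qed

text \<open>If \<open>G > T * d\<close>, the Pinsker terms give \<open>2 * k * T * d^2\<close> and
  the last term \<open>- T * ln (1 - d)\<close>, both up to boundary losses. The surplus of the
  latter over \<open>2 * T * d^2\<close> covers the losses, so the chain exceeds
  \<open>T * ln S = 2 * (k + 1) * T * d^2\<close>.\<close>

lemma fsp_gain_le:
  fixes T S k :: nat and G d W :: real
  assumes G1: "G < T" and G2: "T * ln (T / (T - G)) \<le> T * ln S"
    and chain: "k \<le> G \<Longrightarrow> (\<Sum>j<k. 2 * (G - j)\<^sup>2 / (real T - j)) + (real T - k) * ln ((real T - k) / (T - G)) \<le> T * ln S"
    and S: "S \<ge> 1" and d: "d = sqrt (ln S / (2 * (real k + 1)))" and d1: "d < 1"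
    and W: "1693 / 1000 * 2 ^ k \<le> W" and T: "T * (1 - d) > sqrt (2 * W * (T * d)) + W"
  shows "G \<le> T * d"
proof (rule ccontr)
  assume "\<not> G \<le> T * d"
  then have Gd: "G > T * d" by simp
  have W0: "W > 0" using W less_le_trans[of 0 "1693 / 1000 * 2 ^ k" W] by simp
  have d0: "d \<ge> 0" using S by (simp add: d)
  have "T * (1 - d) > 0"
  proof -
    have "0 \<le> sqrt (2 * W * (T * d))" using W0 d0 by simp
    then show ?thesis using T W0 by linarith
  qed
  then have T0: "real T > 0" using d1 by (simp add: zero_less_mult_iff)
  have d2: "ln S = 2 * (real k + 1) * d\<^sup>2" using S by (simp add: d)
  \<comment> \<open>For \<open>S = 1\<close> the bound \<open>G2\<close> already rules out
    \<open>G > 0\<close>. Otherwise \<open>ln S >= ln 2\<close>, as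
    \<open>boundary_terms_bound\<close> requires.\<close>
  have "S \<noteq> 1"
  proof
    assume "S = 1"
    then have "ln (T / (T - G)) \<le> 0" using G2 T0 by (simp add: mult_le_0_iff)
    moreover have "G > 0" using Gd d0 T0 le_less_trans[of 0 "T * d" G] by simp
    then have "T / (T - G) > 1" using G1 by simp
    then have "ln (T / (T - G)) > 0" by simp
    ultimately show False by simp
  qed
  then have S2: "ln 2 \<le> ln S" using S by simp
  have "ln S > 0" using S2 ln_gt_zero[of "2::real"] by linarith
  then have dpos: "d > 0" by (simp add: d)
  define e where "e = sqrt (d * (2 - d))"
  have e2: "e\<^sup>2 = d * (2 - d)" using dpos d1 by (simp add: e_def)
  have e0: "e > 0" using dpos d1 by (simp add: e_def)
  have de: "d < e"
    unfolding e_def using dpos d1 by (intro real_less_rsqrt) (simp add: power2_eq_square)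
  have "(1 - d)\<^sup>2 = 1 - e\<^sup>2" using e2 by (simp add: power2_eq_square algebra_simps)
  then have "e\<^sup>2 < 1\<^sup>2" using d1 zero_less_power2[of "1 - d"] by simp
  then have e1: "e < 1" by (rule power2_less_imp_less) simp
  text \<open>Solving the quadratic inequality for sqrt (T / W) gives 1 / (1 - e).\<close>
  have TW: "W < T * (1 - e)"
  proof (rule ccontr)
    assume "\<not> W < T * (1 - e)"
    then have We: "T * (1 - e) \<le> W" by simp
    have "(e - d)\<^sup>2 = 2 * (1 - e) * d"
      using e2 by (simp add: power2_eq_square algebra_simps)
    then have "(T * (e - d))\<^sup>2 = 2 * (T * (1 - e)) * (T * d)"
      by (simp add: power_mult_distrib) (simp add: power2_eq_square)
    also have "\<dots> \<le> 2 * W * (T * d)"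
      using We d0 by (intro mult_right_mono) auto
    finally have "T * (e - d) \<le> sqrt (2 * W * (T * d))"
      by (rule real_le_rsqrt)
    then have "T * (1 - d) \<le> sqrt (2 * W * (T * d)) + W"
      using We by (simp add: algebra_simps)
    then show False using T by simp
  qed
  define p where "p = - ln (1 - d)"
  have pd: "p \<ge> 2 * d\<^sup>2"
    using minus_ln_minus_two_sq_mono[of 0 d] d0 d1 by (simp add: p_def)
  have num: "k * ((real k - 1) * e\<^sup>2 + 1 + p) \<le> T * (p - 2 * d\<^sup>2)"
  proof (cases "k = 0")
    case True
    then show ?thesis using pd by simp
  next
    case False
    have "k * (1 - e) * ((real k - 1) * e\<^sup>2 + 1 + p) \<le> 1693 / 1000 * 2 ^ k * (p - 2 * d\<^sup>2)"
      using boundary_terms_bound[of k d e] False dpos d1 S2 d2 by (simp add: e_def p_def)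
    also have "\<dots> \<le> T * (1 - e) * (p - 2 * d\<^sup>2)"
      using W TW pd by (intro mult_right_mono) auto
    finally have "(1 - e) * (k * ((real k - 1) * e\<^sup>2 + 1 + p)) \<le> (1 - e) * (T * (p - 2 * d\<^sup>2))"
      by (simp add: mult_ac)
    then show ?thesis using e1 by simp
  qed
  have kT: "real k < T"
  proof -
    have "real k < 2 ^ k" by (rule of_nat_less_two_power)
    also have "\<dots> \<le> 1693 / 1000 * 2 ^ k" by simp
    also note W
    also note TW
    also have "T * (1 - e) \<le> real T * 1" using e0 by (intro mult_left_mono) auto
    finally show ?thesis by simp
  qed
  \<comment> \<open>Follows from \<open>num\<close> since \<open>p - 2 * d^2 <= d * (1 + p)\<close>;
    it makes \<open>T * d - j\<close> nonnegative, so squares may be compared.\<close>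
  have kTd: "k \<le> T * d"
  proof (cases "k = 0")
    case False
    have "ln (1 / (1 - d)) \<le> 1 / (1 - d) - 1" using d1 by (intro ln_le_minus_one) simp
    also have "\<dots> = d / (1 - d)" using d1 by (simp add: field_simps)
    finally have "p \<le> d / (1 - d)" using d1 by (simp add: p_def ln_div)
    then have "p * (1 - d) \<le> d" using d1 by (simp add: pos_le_divide_eq)
    moreover have "p * (1 - d) = p - d * p" "d * (1 + p) = d + d * p" by (simp_all add: algebra_simps)
    moreover have "0 \<le> d\<^sup>2" by simp
    ultimately have "p - 2 * d\<^sup>2 \<le> d * (1 + p)" by linarith
    then have "T * (p - 2 * d\<^sup>2) \<le> T * (d * (1 + p))" by (intro mult_left_mono) auto
    moreover have "k * (1 + p) \<le> k * ((real k - 1) * e\<^sup>2 + 1 + p)"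
      using False by (intro mult_left_mono) auto
    ultimately have "k * (1 + p) \<le> T * d * (1 + p)" using num by (simp add: mult_ac)
    moreover have "1 + p > 0" using pd zero_le_power2[of d] by linarith
    ultimately show ?thesis by simp
  qed (use dpos in simp)
  have kG: "k \<le> G" using kTd Gd by simp
  have sum_ge: "2 * real k * T * d\<^sup>2 - k * (real k - 1) * e\<^sup>2 \<le> (\<Sum>j<k. 2 * (G - j)\<^sup>2 / (real T - j))"
  proof -
    \<comment> \<open>As a function of \<open>j\<close>, \<open>(T * d - j)^2 / (T - j)\<close> is
      convex and lies above its tangent at \<open>j = 0\<close>, whose slope is
      \<open>- e^2\<close>.\<close>
    have each: "2 * (T * d\<^sup>2 - real j * e\<^sup>2) \<le> 2 * (G - j)\<^sup>2 / (real T - j)" if j: "j < k" for j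
    proof -
      have Tj: "real T - j > 0" using j kT by simp
      have "(T * d - j)\<^sup>2 \<le> (G - j)\<^sup>2"
        using Gd kTd j by (intro power_mono) auto
      moreover have "(T * d\<^sup>2 - real j * e\<^sup>2) * (real T - j) \<le> (T * d - j)\<^sup>2"
      proof -
        have "(T * d - j)\<^sup>2 - (T * d\<^sup>2 - real j * e\<^sup>2) * (real T - j) = (j * (1 - d))\<^sup>2"
          unfolding e2 by (simp add: power2_eq_square algebra_simps)
        then show ?thesis using zero_le_power2[of "j * (1 - d)"] by linarith
      qed
      ultimately have "2 * (T * d\<^sup>2 - real j * e\<^sup>2) * (real T - j) \<le> 2 * (G - j)\<^sup>2" by linarith
      then show ?thesis using Tj by (subst pos_le_divide_eq)
    qed
    have "(\<Sum>j<m. 2 * (T * d\<^sup>2 - real j * e\<^sup>2)) = 2 * real m * T * d\<^sup>2 - m * (real m - 1) * e\<^sup>2" for m :: nat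
      by (induction m) (simp_all add: algebra_simps)
    then have "2 * real k * T * d\<^sup>2 - k * (real k - 1) * e\<^sup>2 = (\<Sum>j<k. 2 * (T * d\<^sup>2 - real j * e\<^sup>2))"
      by (rule sym)
    also have "\<dots> \<le> (\<Sum>j<k. 2 * (G - j)\<^sup>2 / (real T - j))"
      by (rule sum_mono, rule each) (simp only: lessThan_iff)
    finally show ?thesis .
  qed
  \<comment> \<open>With \<open>y = k / T\<close>, the bound
    \<open>ln (1 - y) >= - y / (1 - y)\<close> limits the cost of having only \<open>T - k\<close>
    windows. Strictness comes from \<open>G > T * d\<close>.\<close>
  have last_ge: "T * p - k * (1 + p) < (real T - k) * ln ((real T - k) / (T - G))"
  proof -
    define y where "y = k / T"
    have y: "0 \<le> y" "y < 1" using kT T0 by (auto simp: y_def)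
    have "ln (1 / (1 - y)) \<le> 1 / (1 - y) - 1" using y by (intro ln_le_minus_one) simp
    also have "\<dots> = y / (1 - y)" using y by (simp add: field_simps)
    finally have "- (y / (1 - y)) \<le> ln (1 - y)" using y by (simp add: ln_div)
    then have "(1 - y) * (- (y / (1 - y)) + p) \<le> (1 - y) * (ln (1 - y) + p)"
      using y by (intro mult_left_mono) auto
    moreover have "(1 - y) * (- (y / (1 - y)) + p) = - y + (1 - y) * p"
    proof -
      have "(1 - y) * (y / (1 - y)) = y" using y by simp
      then show ?thesis by (simp only: distrib_left mult_minus_right)
    qed
    ultimately have "- y + (1 - y) * p \<le> (1 - y) * (ln (1 - y) + p)" by linarith
    then have "T * (- y + (1 - y) * p) \<le> T * ((1 - y) * (ln (1 - y) + p))"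
      by (rule mult_left_mono) simp
    moreover have Ty: "T * y = k" using T0 by (simp add: y_def)
    have "T * (- y + (1 - y) * p) = T * p - T * y * (1 + p)" by (simp add: algebra_simps)
    then have "T * (- y + (1 - y) * p) = T * p - k * (1 + p)" by (simp only: Ty)
    moreover have Ty1: "T * (1 - y) = real T - k" using Ty by (simp add: right_diff_distrib)
    moreover have "ln (1 - y) + p = ln ((real T - k) / (T * (1 - d)))"
    proof -
      have "(real T - k) / (T * (1 - d)) = (1 - y) / (1 - d)"
        using T0 by (simp only: Ty1[symmetric]) simp
      then show ?thesis using y d1 by (simp add: p_def ln_div)
    qed
    ultimately have "T * p - k * (1 + p) \<le> (real T - k) * ln ((real T - k) / (T * (1 - d)))"
      by (simp only: mult.assoc[symmetric])
    also have "\<dots> < (real T - k) * ln ((real T - k) / (T - G))"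
    proof -
      have "T - G < T * (1 - d)" using Gd by (simp add: right_diff_distrib)
      moreover have "0 < T * (1 - d)" using T0 d1 by simp
      moreover have "0 < (T * (1 - d)) * (T - G)" using T0 d1 G1 by simp
      ultimately have "(real T - k) / (T * (1 - d)) < (real T - k) / (T - G)"
        using kT by (intro divide_strict_left_mono) simp_all
      moreover have "0 < (real T - k) / (T * (1 - d))" using kT T0 d1 by simp
      ultimately have "ln ((real T - k) / (T * (1 - d))) < ln ((real T - k) / (T - G))"
        by (rule ln_less_cancel_iff[THEN iffD2, rotated 2]) (use kT G1 in simp)
      then show ?thesis using kT by (intro mult_strict_left_mono) simp_all
    qed
    finally show ?thesis .
  qed
  have "T * ln S = 2 * real k * T * d\<^sup>2 + 2 * (T * d\<^sup>2)"
    by (simp add: d2 algebra_simps)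
  then have "T * p - 2 * (T * d\<^sup>2) < k * (real k - 1) * e\<^sup>2 + k * (1 + p)"
    using sum_ge last_ge chain[OF kG] by linarith
  moreover have "k * (real k - 1) * e\<^sup>2 + k * (1 + p) = k * ((real k - 1) * e\<^sup>2 + 1 + p)"
    by (simp only: distrib_left mult.assoc add.assoc)
  moreover have "T * p - 2 * (T * d\<^sup>2) = T * (p - 2 * d\<^sup>2)"
    by (simp only: right_diff_distrib mult.left_commute)
  ultimately show False using num by linarith
qed

subsection \<open>Sage on the Markov states\<close>

lemma finite_files: "finite (files N)" and card_files: "card (files N) = N"
  by (simp_all add: files_def)

lemma finite_csets: "finite (csets N C)"
  by (rule finite_subset[of _ "Pow (files N)"]) (auto simp: csets_def finite_files)

lemma card_csets: "card (csets N C) = N choose C"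
  unfolding csets_def using n_subsets[OF finite_files, of N C] by (simp add: card_files)

lemma csets_nonempty: "C \<le> N \<Longrightarrow> csets N C \<noteq> {}"
  using card_csets[of N C] by (metis binomial_eq_0_iff card.empty not_le)

lemma hit_prob_eq_sum:
  assumes "set_pmf \<mu> \<subseteq> csets N C"
  shows "hit_prob \<mu> x = (\<Sum>A\<in>csets N C. pmf \<mu> A * of_bool (x \<in> A))"
proof -
  have "hit_prob \<mu> x = measure_pmf.prob \<mu> ({A. x \<in> A} \<inter> set_pmf \<mu>)"
    by (simp add: hit_prob_def measure_Int_set_pmf)
  also have "{A. x \<in> A} \<inter> set_pmf \<mu> = ({A. x \<in> A} \<inter> csets N C) \<inter> set_pmf \<mu>" using assms by auto
  also have "measure_pmf.prob \<mu> \<dots> = measure_pmf.prob \<mu> ({A. x \<in> A} \<inter> csets N C)"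
    by (rule measure_Int_set_pmf)
  also have "\<dots> = (\<Sum>A\<in>{A. x \<in> A} \<inter> csets N C. pmf \<mu> A)"
    by (intro measure_measure_pmf_finite) (simp add: finite_csets)
  also have "{A. x \<in> A} \<inter> csets N C = {A \<in> csets N C. x \<in> A}" by auto
  also have "(\<Sum>A\<in>\<dots>. pmf \<mu> A) = (\<Sum>A\<in>csets N C. if x \<in> A then pmf \<mu> A else 0)"
    by (rule sum.inter_filter[OF finite_csets])
  also have "\<dots> = (\<Sum>A\<in>csets N C. pmf \<mu> A * of_bool (x \<in> A))"
    by (intro sum.cong) auto
  finally show ?thesis .
qed

lemma fixed_hits_eq_sum: "real (fixed_hits A ys) = (\<Sum>i<length ys. of_bool (ys ! i \<in> A))"
proof -
  have "(\<Sum>i<length ys. of_bool (ys ! i \<in> A)) = (\<Sum>i<length ys. if ys ! i \<in> A then 1 else 0 :: real)"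
    by (intro sum.cong) auto
  also have "\<dots> = real (card {i \<in> {..<length ys}. ys ! i \<in> A})"
    by (simp add: sum.inter_filter[symmetric])
  finally show ?thesis by (simp add: fixed_hits_def)
qed

lemma fixed_hits_le: "fixed_hits A ys \<le> length ys"
  using card_mono[of "{..<length ys}" "{t. t < length ys \<and> ys ! t \<in> A}"]
  by (auto simp: fixed_hits_def)

lemma best_fixed_hits_le:
  assumes "C \<le> N"
  shows "best_fixed_hits N C ys \<le> length ys"
  unfolding best_fixed_hits_def
  using finite_csets csets_nonempty[OF assms] by (auto simp: fixed_hits_le)

text \<open>A randomized cache is a mixture of fixed \<open>C\<close>-sets, so its hits average
  those of fixed sets.\<close>

lemma sum_hit_prob_le_best:
  assumes "set_pmf \<mu> \<subseteq> csets N C"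
  shows "(\<Sum>i<length ys. hit_prob \<mu> (ys ! i)) \<le> best_fixed_hits N C ys"
proof -
  have "(\<Sum>i<length ys. hit_prob \<mu> (ys ! i))
      = (\<Sum>A\<in>csets N C. pmf \<mu> A * (\<Sum>i<length ys. of_bool (ys ! i \<in> A)))"
    unfolding hit_prob_eq_sum[OF assms] by (subst sum.swap) (simp add: sum_distrib_left[symmetric] mult.commute)
  also have "\<dots> \<le> (\<Sum>A\<in>csets N C. pmf \<mu> A * best_fixed_hits N C ys)"
    unfolding fixed_hits_eq_sum[symmetric] best_fixed_hits_def
    by (intro sum_mono mult_left_mono) (auto simp: finite_csets)
  also have "\<dots> = best_fixed_hits N C ys"
    using sum_pmf_eq_1[OF finite_csets assms] by (simp add: sum_distrib_right[symmetric])
  finally show ?thesis .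
qed

lemma hit_prob_uniform:
  assumes "1 \<le> C" "C \<le> N" "x \<in> files N"
  shows "hit_prob (pmf_of_set (csets N C)) x = C / N"
proof -
  have "{A \<in> csets N C. x \<notin> A} = {A. A \<subseteq> files N - {x} \<and> card A = C}"
    by (auto simp: csets_def)
  then have out: "card {A \<in> csets N C. x \<notin> A} = (N - 1) choose C"
    using n_subsets[of "files N - {x}" C] assms(3) by (simp add: finite_files card_files)
  have "csets N C = {A \<in> csets N C. x \<in> A} \<union> {A \<in> csets N C. x \<notin> A}" by auto
  then have "card (csets N C) = card {A \<in> csets N C. x \<in> A} + card {A \<in> csets N C. x \<notin> A}"
    by (metis (no_types, lifting) card_Un_disjoint disjoint_iff finite_Un finite_csets mem_Collect_eq)
  then have "card {A \<in> csets N C. x \<in> A} = (N - 1) choose (C - 1)"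
    using out choose_reduce_nat[of N C] assms by (simp add: card_csets)
  then have *: "N * card {A \<in> csets N C. x \<in> A} = C * card (csets N C)"
    using times_binomial_minus1_eq[of C N] assms by (simp add: card_csets)
  have pos: "card (csets N C) > 0" using csets_nonempty[OF assms(2)] finite_csets by (simp add: card_gt_0_iff)
  have "hit_prob (pmf_of_set (csets N C)) x = card (csets N C \<inter> {A. x \<in> A}) / card (csets N C)"
    unfolding hit_prob_def using csets_nonempty[OF assms(2)] finite_csets by (rule measure_pmf_of_set)
  also have "csets N C \<inter> {A. x \<in> A} = {A \<in> csets N C. x \<in> A}" by auto
  also have "card {A \<in> csets N C. x \<in> A} / card (csets N C) = C / N"
    using arg_cong[OF *, of real] pos assms by (simp add: frac_eq_eq mult.commute)
  finally show ?thesis .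
qed

text \<open>A uniformly random \<open>C\<close>-set hits each file with probability
  \<open>C / N\<close>. This yields the branch \<open>1 - C / N\<close> of the minimum.\<close>

lemma markov_Lstar_le_uniform:
  assumes "1 \<le> C" "C \<le> N" "valid_seq N xs"
  shows "markov_Lstar N C pre xs \<le> length xs * (1 - C / N)"
proof -
  have "markov_Lstar N C pre xs \<le> markov_misses pre (\<lambda>_. pmf_of_set (csets N C)) xs"
    using csets_nonempty[OF assms(2)] finite_csets by (intro markov_Lstar_le) simp
  also have "\<dots> = (\<Sum>t<length xs. 1 - C / N)"
    unfolding markov_misses_def
    by (intro sum.cong refl) (use assms in \<open>auto simp: valid_seq_def subset_iff hit_prob_uniform\<close>)
  finally show ?thesis by simp
qed

lemma sage_marg_nonneg: "0 \<le> sage_marg N C eta h i"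
  unfolding sage_marg_def Let_def esym_def
  by (intro divide_nonneg_nonneg mult_nonneg_nonneg sum_nonneg prod_nonneg) auto

text \<open>With \<open>v = \<sigma> t\<close> and \<open>n = t\<close> this is the history seen at
  round \<open>t\<close> by the Sage copy in charge.\<close>

definition substream :: "(nat \<Rightarrow> 's) \<Rightarrow> nat list \<Rightarrow> 's \<Rightarrow> nat \<Rightarrow> nat list" where
  "substream \<sigma> xs v n = [xs ! j. j \<leftarrow> [0..<n], \<sigma> j = v]"

lemma substream_Suc: "substream \<sigma> xs v (Suc n) = substream \<sigma> xs v n @ (if \<sigma> n = v then [xs ! n] else [])"
  by (simp add: substream_def)

text \<open>A round in state \<open>v\<close> is one step of the substream of \<open>v\<close>, and
  the history available then is a prefix of that substream.\<close>

lemma sum_by_state: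
  fixes \<phi> :: "'s \<Rightarrow> nat list \<Rightarrow> nat \<Rightarrow> real"
  assumes "finite V" "\<And>t. t < n \<Longrightarrow> \<sigma> t \<in> V"
  shows "(\<Sum>t<n. \<phi> (\<sigma> t) (substream \<sigma> xs (\<sigma> t) t) (xs ! t))
    = (\<Sum>v\<in>V. \<Sum>i<length (substream \<sigma> xs v n). \<phi> v (take i (substream \<sigma> xs v n)) (substream \<sigma> xs v n ! i))"
  using assms(2)
proof (induction n)
  case 0
  then show ?case by (simp add: substream_def)
next
  case (Suc n)
  have snoc: "(\<Sum>i<length (h @ [x]). \<phi> v (take i (h @ [x])) ((h @ [x]) ! i))
      = (\<Sum>i<length h. \<phi> v (take i h) (h ! i)) + \<phi> v h x" for v h x
    by (simp add: nth_append)
  have "(\<Sum>i<length (substream \<sigma> xs v (Suc n)). \<phi> v (take i (substream \<sigma> xs v (Suc n))) (substream \<sigma> xs v (Suc n) ! i))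
      = (\<Sum>i<length (substream \<sigma> xs v n). \<phi> v (take i (substream \<sigma> xs v n)) (substream \<sigma> xs v n ! i))
        + (if v = \<sigma> n then \<phi> v (substream \<sigma> xs v n) (xs ! n) else 0)" for v
    unfolding substream_Suc by (cases "v = \<sigma> n") (simp_all only: snoc if_True if_False append_Nil2 add_0_right simp_thms, simp)
  then show ?case using Suc assms(1) by (simp add: sum.distrib)
qed

text \<open>The tuned bound is applied to each substream. Misses of the best fixed sets add up to at
  most \<open>L\<close>, and Cauchy-Schwarz over the \<open>N ^ k\<close> states merges the square
  roots.\<close>

lemma markov_sage_regret:
  fixes N C T k :: nat
  assumes C: "1 \<le> C" "C \<le> N" and xs: "valid_seq N xs" "length xs = T"
    and pre: "valid_seq N pre" "length pre = k" and tuned: "sage_tuned N C eta" and T: "T \<ge> 1"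
  defines "L \<equiv> markov_Lstar N C pre xs" and "W \<equiv> real N ^ k * real C * ln (real N * exp 1 / real C)"
  shows "real T * markov_sage_rate N C eta pre xs \<ge> real T - L - sqrt (2 * W * L) - W"
proof -
  define \<sigma> where "\<sigma> = markov_state pre xs"
  define V where "V = {v. set v \<subseteq> files N \<and> length v = k}"
  define ys where "ys v = substream \<sigma> xs v T" for v
  define b where "b v = real (best_fixed_hits N C (ys v))" for v
  define l where "l v = real (length (ys v) - best_fixed_hits N C (ys v))" for v
  define \<kappa> where "\<kappa> = ln (real N * exp 1 / real C)"
  have \<kappa>: "\<kappa> \<ge> 0"
  proof -
    have "real N * exp 1 / real C \<ge> 1"
    proof -
      have "real C * 1 \<le> real N * exp 1" using C by (intro mult_mono) auto
      then show ?thesis using C by (simp add: le_divide_eq)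
    qed
    then show ?thesis by (simp add: \<kappa>_def)
  qed
  have fV: "finite V" unfolding V_def using finite_lists_length_eq[OF finite_files] by simp
  have cV: "real (card V) = real N ^ k"
    unfolding V_def by (subst card_lists_length_eq[OF finite_files]) (simp add: card_files)
  have \<sigma>V: "\<sigma> t \<in> V" for t
  proof -
    have "set (take t xs) \<subseteq> files N" using xs set_take_subset[of t xs] by (auto simp: valid_seq_def)
    then have "set (\<sigma> t) \<subseteq> files N"
      unfolding \<sigma>_def markov_state_def using pre set_take_subset[of k "rev (pre @ take t xs)"]
      by (auto simp: valid_seq_def)
    then show ?thesis using pre by (simp add: V_def \<sigma>_def markov_state_def)
  qed
  have l_eq: "l v = length (ys v) - b v" for v
    unfolding l_def b_def by (rule of_nat_diff[OF best_fixed_hits_le[OF C(2)]])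
  have "real T * markov_sage_rate N C eta pre xs = (\<Sum>t<T. sage_marg N C eta (substream \<sigma> xs (\<sigma> t) t) (xs ! t))"
    using T by (simp add: markov_sage_rate_def xs substream_def \<sigma>_def)
  also have "\<dots> = (\<Sum>v\<in>V. sage_hits N C eta (ys v))"
    unfolding sage_hits_def ys_def
    by (rule sum_by_state[of V T \<sigma> "\<lambda>_. sage_marg N C eta" xs, OF fV \<sigma>V])
  finally have sage: "real T * markov_sage_rate N C eta pre xs = (\<Sum>v\<in>V. sage_hits N C eta (ys v))" .
  have len: "real T = (\<Sum>v\<in>V. real (length (ys v)))"
    using sum_by_state[of V T \<sigma> "\<lambda>_ _ _. 1" xs, OF fV \<sigma>V] by (simp add: ys_def)
  have valid: "valid_seq N (ys v)" for v
    using xs unfolding valid_seq_def ys_def substream_def by (auto split: if_splits)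
  \<comment> \<open>A Markov prefetcher plays one fixed mixture of \<open>C\<close>-sets on each
    substream.\<close>
  have Ll: "(\<Sum>v\<in>V. l v) \<le> L"
    unfolding L_def markov_Lstar_def
  proof (rule cINF_greatest)
    obtain A where "A \<in> csets N C" using csets_nonempty[OF C(2)] by auto
    then have "(\<lambda>_. return_pmf A) \<in> {f. \<forall>s. set_pmf (f s) \<subseteq> csets N C}" by simp
    then show "{f. \<forall>s. set_pmf (f s) \<subseteq> csets N C} \<noteq> {}"
      by (rule ex_in_conv[THEN iffD1, OF exI])
    fix f :: "nat list \<Rightarrow> nat set pmf" assume f: "f \<in> {f. \<forall>s. set_pmf (f s) \<subseteq> csets N C}"
    have "(\<Sum>t<T. hit_prob (f (\<sigma> t)) (xs ! t)) = (\<Sum>v\<in>V. \<Sum>i<length (ys v). hit_prob (f v) (ys v ! i))"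
      unfolding ys_def by (rule sum_by_state[of V T \<sigma> "\<lambda>v _. hit_prob (f v)" xs, OF fV \<sigma>V])
    also have "\<dots> \<le> (\<Sum>v\<in>V. b v)"
      unfolding b_def using f by (intro sum_mono sum_hit_prob_le_best) auto
    finally show "(\<Sum>v\<in>V. l v) \<le> markov_misses pre f xs"
      by (simp add: markov_misses_eq xs l_eq sum_subtractf len \<sigma>_def[symmetric])
  qed
  have l0: "l v \<ge> 0" for v by (simp add: l_def)
  have "(\<Sum>v\<in>V. sqrt (2 * real C * l v * \<kappa>))\<^sup>2 \<le> real (card V) * (\<Sum>v\<in>V. (sqrt (2 * real C * l v * \<kappa>))\<^sup>2)"
    using sum_squared_le_sum_of_squares[of "\<lambda>v. sqrt (2 * real C * l v * \<kappa>)" V] by (simp only: mult.commute)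
  also have "\<dots> = 2 * W * (\<Sum>v\<in>V. l v)"
    using l0 \<kappa> unfolding cV W_def \<kappa>_def[symmetric] by (simp add: sum_distrib_left sum_distrib_right mult_ac)
  also have "\<dots> \<le> 2 * W * L"
    using Ll \<kappa> unfolding W_def \<kappa>_def[symmetric] by (intro mult_left_mono) auto
  finally have cs: "(\<Sum>v\<in>V. sqrt (2 * real C * l v * \<kappa>)) \<le> sqrt (2 * W * L)"
    by (rule real_le_rsqrt)
  have "(\<Sum>v\<in>V. b v - sqrt (2 * real C * l v * \<kappa>) - C * \<kappa>) \<le> (\<Sum>v\<in>V. sage_hits N C eta (ys v))"
  proof (rule sum_mono)
    fix v
    show "b v - sqrt (2 * real C * l v * \<kappa>) - C * \<kappa> \<le> sage_hits N C eta (ys v)"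
      unfolding b_def l_def \<kappa>_def
      by (rule tuned[unfolded sage_tuned_def, THEN conjunct2, rule_format, OF valid])
  qed
  moreover have "(\<Sum>v\<in>V. b v - sqrt (2 * real C * l v * \<kappa>) - C * \<kappa>)
      = (real T - (\<Sum>v\<in>V. l v)) - (\<Sum>v\<in>V. sqrt (2 * real C * l v * \<kappa>)) - W"
    by (simp add: sum_subtractf l_eq len W_def \<kappa>_def cV)
  ultimately show ?thesis using sage cs Ll by linarith
qed

section \<open>Combining regret and prefetcher gain\<close>

text \<open>\<open>C < N\<close> forces \<open>N >= 2\<close>. For \<open>C = 1\<close> the last two
  factors give \<open>1 + ln N\<close>, at least \<open>1 + ln 2\<close>; for \<open>C >= 2\<close>
  they give at least 2.\<close>

lemma regret_constant_ge:
  assumes C: "1 \<le> C" "C < N"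
  shows "1693 / 1000 * 2 ^ k \<le> real N ^ k * real C * ln (real N * exp 1 / real C)"
proof -
  have NC: "real N / real C \<ge> 1" using C by simp
  have ln: "ln (real N * exp 1 / real C) = ln (real N / real C) + 1"
    using C by (simp add: ln_div ln_mult)
  have "1693 / 1000 \<le> real C * ln (real N * exp 1 / real C)"
  proof (cases "C = 1")
    case True
    then have "ln 2 \<le> ln (real N)" using C by simp
    then show ?thesis using ln ln2_bound True by simp
  next
    case False
    then have "2 * 1 \<le> real C * ln (real N * exp 1 / real C)"
      unfolding ln using C NC by (intro mult_mono) auto
    then show ?thesis by simp
  qed
  moreover have "(2::real) ^ k \<le> real N ^ k" using C by (intro power_mono) auto
  ultimately have "2 ^ k * (1693 / 1000) \<le> real N ^ k * (real C * ln (real N * exp 1 / real C))"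
    by (intro mult_mono) auto
  then show ?thesis by (simp add: mult_ac)
qed

text \<open>Arguing by contradiction makes \<open>T\<close> large: the hits of the prefetcher number
  at most \<open>T\<close> and those of Sage at least 0, so a failure forces \<open>T\<close> above
  the whole right side.\<close>

lemma fsp_minus_sage_le:
  fixes N C T S k :: nat
  assumes C: "1 \<le> C" "C \<le> N" and T: "T \<ge> 1" and S: "S \<ge> 1"
    and xs: "length xs = T" "valid_seq N xs" and pre: "length pre = k" "valid_seq N pre"
    and tuned: "sage_tuned N C eta" and fsp: "is_FSP N C Q g f s0" "card Q \<le> S"
  defines "W \<equiv> real N ^ k * real C * ln (real N * exp 1 / real C)" and "L \<equiv> markov_Lstar N C pre xs"
  shows "T * (fsp_hit_rate g f s0 xs - markov_sage_rate N C eta pre xs)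
    \<le> T * min (1 - C / N) (sqrt (ln S / (2 * (real k + 1)))) + sqrt (2 * W * L) + W"
proof (rule ccontr)
  define d where "d = sqrt (ln S / (2 * (real k + 1)))"
  define F where "F = (\<Sum>t<T. hit_prob (f (fsp_state g s0 xs t)) (xs ! t))"
  define R where "R = real T * markov_sage_rate N C eta pre xs"
  define G where "G = F - (real T - L)"
  assume "\<not> ?thesis"
  moreover have "T * fsp_hit_rate g f s0 xs = F"
    using T by (simp add: fsp_hit_rate_def F_def xs)
  ultimately have gt: "F - R > T * min (1 - C / N) d + sqrt (2 * W * L) + W"
    by (simp add: right_diff_distrib R_def d_def)
  have R: "R \<ge> real T - L - sqrt (2 * W * L) - W"
    unfolding R_def L_def W_def using markov_sage_regret[OF C xs(2,1) pre(2,1) tuned T] by simp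
  have R0: "R \<ge> 0"
    unfolding R_def markov_sage_rate_def
    by (intro mult_nonneg_nonneg divide_nonneg_nonneg sum_nonneg sage_marg_nonneg) auto
  have "F \<le> (\<Sum>t<T. 1)" unfolding F_def by (intro sum_mono hit_prob_bounds)
  then have FT: "F \<le> T" by simp
  have G: "G > T * min (1 - C / N) d" using gt R by (simp add: G_def)
  have "L \<le> T * (1 - C / N)"
    unfolding L_def using markov_Lstar_le_uniform[OF C xs(2), of pre] xs by simp
  \<comment> \<open>The gain always respects the branch \<open>1 - C / N\<close>, so only the branch
    \<open>d\<close> can fail.\<close>
  then have "G \<le> T * (1 - C / N)" using FT by (simp add: G_def)
  then have "min (1 - C / N) d \<noteq> 1 - C / N" using G by auto
  then have dC: "d < 1 - C / N" and m: "min (1 - C / N) d = d" by (auto simp: min_def split: if_splits)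
  have d0: "d \<ge> 0" using S by (simp add: d_def)
  have CN: "C < N"
  proof (rule ccontr)
    assume "\<not> C < N"
    then have "C = N" using C by simp
    then show False using dC d0 C by simp
  qed
  have d1: "d < 1"
  proof -
    have "C / N \<ge> 0" by simp
    then show ?thesis using dC by linarith
  qed
  have W: "1693 / 1000 * 2 ^ k \<le> W"
    unfolding W_def by (rule regret_constant_ge[OF C(1) CN])
  have W0: "W \<ge> 0" using W order_trans[of 0 "1693 / 1000 * 2 ^ k" W] by simp
  \<comment> \<open>This replaces \<open>L\<close> by \<open>T * d\<close> under the square root,
    leaving a condition on \<open>T\<close>, \<open>W\<close> and \<open>d\<close> alone.\<close>
  have LTd: "T * d \<le> L" using G FT by (simp add: G_def m)
  have Tbig: "T > T * d + sqrt (2 * W * L) + W" using gt R0 FT by (simp add: m)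
  moreover have "sqrt (2 * W * (T * d)) \<le> sqrt (2 * W * L)"
    using LTd W0 by (intro real_sqrt_le_mono mult_left_mono) auto
  moreover have "T * (1 - d) = T - T * d" by (simp add: right_diff_distrib)
  ultimately have T': "T * (1 - d) > sqrt (2 * W * (T * d)) + W" by linarith
  have kT: "k < T"
  proof -
    have "real k < 2 ^ k" by (rule of_nat_less_two_power)
    also have "\<dots> \<le> 1693 / 1000 * 2 ^ k" by simp
    also note W
    also have "W \<le> T"
    proof -
      have "T * d \<ge> 0" "sqrt (2 * W * L) \<ge> 0"
        using d0 W0 LTd order_trans[of 0 "T * d" L] by simp_all
      then show ?thesis using Tbig by linarith
    qed
    finally show ?thesis by simp
  qed
  note chain = fsp_entropy_chain[OF fsp S xs(2,1) pre(1) kT, folded L_def F_def, folded G_def]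
  have "G \<le> T * d"
    by (rule fsp_gain_le[OF chain S d_def d1 W T'])
  then show False using G m by simp
qed

theorem theorem2:
  fixes N C T S k :: nat and xs pre :: "nat list" and eta :: "nat list \<Rightarrow> real"
  assumes "N \<ge> 1" and "1 \<le> C" and "C \<le> N" and "T \<ge> 1" and "S \<ge> 1"
    and "length xs = T" and "valid_seq N xs"
    and "length pre = k" and "valid_seq N pre"
    and "sage_tuned N C eta"
  shows "real T * (best_fsp_rate N C S xs - markov_sage_rate N C eta pre xs)
     \<le> real T * min (1 - real C / real N) (sqrt (ln (real S) / (2 * (real k + 1))))
       + sqrt (2 * real N ^ k * real C * markov_Lstar N C pre xs * ln (real N * exp 1 / real C))
       + real N ^ k * real C * ln (real N * exp 1 / real C)"
proof -
  define W where "W = real N ^ k * real C * ln (real N * exp 1 / real C)"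
  define B where "B = real T * min (1 - real C / real N) (sqrt (ln (real S) / (2 * (real k + 1))))
    + sqrt (2 * W * markov_Lstar N C pre xs) + W"
  obtain A where A: "A \<in> csets N C" using csets_nonempty[OF assms(3)] by auto
  \<comment> \<open>A one-state prefetcher shows that the supremum ranges over a nonempty
    set.\<close>
  have "is_FSP N C {0} (\<lambda>_ _. 0) (\<lambda>_. return_pmf A) 0" using A by (simp add: is_FSP_def)
  then have "({0}, \<lambda>_ _. 0, \<lambda>_. return_pmf A, 0) \<in> {(Q, g, f, s0). is_FSP N C Q g f s0 \<and> card Q \<le> S}"
    using assms(5) by simp
  then have ne: "{(Q, g, f, s0). is_FSP N C Q g f s0 \<and> card Q \<le> S} \<noteq> {}" by blast
  have "best_fsp_rate N C S xs \<le> markov_sage_rate N C eta pre xs + B / T"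
    unfolding best_fsp_rate_def
  proof (rule cSUP_least[OF ne])
    fix z assume z: "z \<in> {(Q, g, f, s0). is_FSP N C Q g f s0 \<and> card Q \<le> S}"
    obtain Q g f s0 where z': "z = (Q, g, f, s0)" by (metis prod_cases4)
    have "T * (fsp_hit_rate g f s0 xs - markov_sage_rate N C eta pre xs) \<le> B"
      unfolding B_def W_def
      using z z' by (intro fsp_minus_sage_le[OF assms(2-9) assms(10)]) auto
    then show "(case z of (Q, g, f, s0) \<Rightarrow> fsp_hit_rate g f s0 xs) \<le> markov_sage_rate N C eta pre xs + B / T"
      using assms(4) by (simp add: z' field_simps)
  qed
  then have le: "real T * (best_fsp_rate N C S xs - markov_sage_rate N C eta pre xs) \<le> B"
    using assms(4) by (simp add: field_simps)
  have L: "2 * W * markov_Lstar N C pre xs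
      = 2 * real N ^ k * real C * markov_Lstar N C pre xs * ln (real N * exp 1 / real C)"
    by (simp add: W_def)
  show ?thesis using le unfolding B_def L unfolding W_def .
qed

end
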